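(* Let $\mathbb F$ be a field and let $q\in\mathbb F$ be nonzero and not a root of $1$. Assume that $\mathbb F$ contains a square root of $q$. Pick $\theta\in\mathbb F$ such that $\theta^2=q$ or $\theta^2=q^{-1}$, and pick $t\in\mathbb Z$. Define $q^{1/2}=-\theta$ if $\theta^2=q$, and $q^{1/2}=\theta^{-1}$ if $\theta^2=q^{-1}$. Let $\mathfrak R$ be the operator that acts on each finite-dimensional $U_q(\mathfrak{sl}_2)$-module of type 1 as $\mathfrak R=\exp_q(n_x)\,\Upsilon\,\exp_q(n_z)$. Then on each finite-dimensional $U_q(\mathfrak{sl}_2)$-module of type 1 the following hold. \begin{itemize} \item If $\theta^2=q$ and the primary identification of type $(\theta,t)$ is used, then $T^{-1}=\exp_q(n_z)\,\mathfrak R$. \item If $\theta^2=q$ and the secondary identification of type $(\theta,t)$ is used, then $(T^\vee)^{-1}=\exp_q(n_z)\,\mathfrak R$. \item If $\theta^2=q^{-1}$ and the primary identification of type $(\theta,t)$ is used, then $(T^\vee)^{-1}=\exp_q(n_z)\,\mathfrak R$. \item If $\theta^2=q^{-1}$ and the secondary identification of type $(\theta,t)$ is used, then $T^{-1}=\exp_q(n_z)\,\mathfrak R$. \end{itemize}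
   Context: Notation: $\mathbb N=\{0,1,2,\dots\}$, $[n]_q=(q^n-q^{-n})/(q-q^{-1})$, $[n]^!_q=[n]_q[n-1]_q\cdots[1]_q$, $[0]^!_q=1$. Chevalley presentation: $U_q(\mathfrak{sl}_2)$ is the $\mathbb F$-algebra (associative, unital) with generators $e,f,k^{\pm1}$ and relations $kk^{-1}=k^{-1}k=1$, $ke=q^2ek$, $kf=q^{-2}fk$, $ef-fe=(k-k^{-1})/(q-q^{-1})$. Equitable presentation: $U_q(\mathfrak{sl}_2)$ is isomorphic to the $\mathbb F$-algebra with generators $x,y^{\pm1},z$ and relations $yy^{-1}=y^{-1}y=1$, $\frac{qxy-q^{-1}yx}{q-q^{-1}}=1$, $\frac{qyz-q^{-1}zy}{q-q^{-1}}=1$, $\frac{qzx-q^{-1}xz}{q-q^{-1}}=1$. For $0\neq\theta\in\mathbb F$ and $t\in\mathbb Z$, the primary identification of type $(\theta,t)$ identifies the two algebras via the isomorphism $x\mapsto k^{-1}-k^{-1-t}e\,q^{1+t}(q-q^{-1})\theta^{-1}$, $y^{\pm1}\mapsto k^{\pm1}$, $z\mapsto k^{-1}+fk^tq^{-t}(q-q^{-1})\theta$; the secondary identification of type $(\theta,t)$ identifies them via the isomorphism $x\mapsto k-k^{1+t}f\,q^{1+t}(q-q^{-1})\theta^{-1}$, $y^{\pm1}\mapsto k^{\mp1}$, $z\mapsto k+ek^{-t}q^{-t}(q-q^{-1})\theta$. Elements: $n_x=\frac{q(1-yz)}{q-q^{-1}}$, $n_y=\frac{q(1-zx)}{q-q^{-1}}$,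 $n_z=\frac{q(1-xy)}{q-q^{-1}}$; each acts nilpotently on every finite-dimensional $U_q(\mathfrak{sl}_2)$-module. For a nilpotent linear map $\varphi$ on a finite-dimensional space, $\exp_q(\varphi)=\sum_{i\in\mathbb N}\frac{q^{\binom i2}}{[i]^!_q}\varphi^i$. Type 1 modules: a nonzero finite-dimensional $U_q(\mathfrak{sl}_2)$-module $V$ has type 1 if it is a direct sum of irreducible submodules each isomorphic to some $\mathbf V_d$ ($d\in\mathbb N$), where $\mathbf V_d$ has basis $v_0,\dots,v_d$ with $kv_i=q^{d-2i}v_i$, $fv_i=[i+1]_qv_{i+1}$ ($0\le i\le d-1$), $fv_d=0$, $ev_i=[d-i+1]_qv_{i-1}$ ($1\le i\le d$), $ev_0=0$. (Equivalently, $k$ is diagonalizable on $V$ with all eigenvalues in $\{q^\lambda\}_{\lambda\in\mathbb Z}$.) For $\lambda\in\mathbb Z$, the weight space is $V(\lambda)=\{v\in V: kv=q^\lambda v\}$; $V$ is the direct sum of its weight spaces. Lusztig operators: $T$ and $T^\vee$ act linearly on each type 1 finite-dimensional module $V$; on $V(\lambda)$, $$T=\sum_{a,b,c\in\mathbb N,\ b-a-c=\lambda}\frac{e^af^be^c}{[a]^!_q[b]^!_q[c]^!_q}(-1)^bq^{b-ac},\qquad T^\vee=\sum_{a,b,c\in\mathbb N,\ a-b+c=\lambda}\frac{f^ae^bf^c}{[a]^!_q[b]^!_q[c]^!_q}(-1)^bq^{b-ac}.$$ Both are invertible on $V$; $T^{-1}$ and $(T^\vee)^{-1}$ denote the inverses.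 The operator $\Upsilon$ acts linearly on each type 1 finite-dimensional module $V$: on $V(\lambda)$ it is $q^{-\lambda^2/2}$ times the identity, where $q^{-\lambda^2/2}=(q^{1/2})^{-\lambda^2}$ and $q^{1/2}$ is the square root of $q$ specified in the claim. *)

theory Defs
  imports Complex_Main "HOL-Library.Groups_Big_Fun"
begin

definition not_root_of_unity :: "'a::field \<Rightarrow> bool" where
  "not_root_of_unity q \<longleftrightarrow> (\<forall>n>0. q ^ n \<noteq> 1)"

definition qint :: "'a::field \<Rightarrow> nat \<Rightarrow> 'a" where
  "qint q n = (q powi (int n) - q powi (- int n)) / (q - inverse q)"

definition qfact :: "'a::field \<Rightarrow> nat \<Rightarrow> 'a" where
  "qfact q n = (\<Prod>i=1..n. qint q i)"

text \<open>
  The algebra is given by generators and relations, so a module structure on a vector space (here a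
  whole type \<open>'v\<close> with scalar multiplication \<open>scl\<close>) is the same as four linear operators, the actions
  of the Chevalley generators, that satisfy the defining relations.
\<close>

record ('a, 'v) uq_structure =
  scl :: "'a \<Rightarrow> 'v \<Rightarrow> 'v"
  e_op :: "'v \<Rightarrow> 'v"
  f_op :: "'v \<Rightarrow> 'v"
  k_op :: "'v \<Rightarrow> 'v"
  kinv_op :: "'v \<Rightarrow> 'v"

definition uq_module :: "'a::field \<Rightarrow> ('a, 'v::ab_group_add) uq_structure \<Rightarrow> bool" where
  "uq_module q M \<longleftrightarrow>
     vector_space (scl M) \<and>
     Vector_Spaces.linear (scl M) (scl M) (e_op M) \<and>
     Vector_Spaces.linear (scl M) (scl M) (f_op M) \<and>
     Vector_Spaces.linear (scl M) (scl M) (k_op M) \<and>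
     Vector_Spaces.linear (scl M) (scl M) (kinv_op M) \<and>
     (\<forall>v. k_op M (kinv_op M v) = v) \<and>
     (\<forall>v. kinv_op M (k_op M v) = v) \<and>
     (\<forall>v. k_op M (e_op M v) = scl M (q ^ 2) (e_op M (k_op M v))) \<and>
     (\<forall>v. k_op M (f_op M v) = scl M (q powi (-2)) (f_op M (k_op M v))) \<and>
     (\<forall>v. e_op M (f_op M v) - f_op M (e_op M v)
        = scl M (inverse (q - inverse q)) (k_op M v - kinv_op M v))"

definition fin_dim :: "('a::field, 'v::ab_group_add) uq_structure \<Rightarrow> bool" where
  "fin_dim M \<longleftrightarrow> (\<exists>B. finite B \<and> module.span (scl M) B = UNIV)"

definition submodule :: "('a::field, 'v::ab_group_add) uq_structure \<Rightarrow> 'v set \<Rightarrow> bool" where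
  "submodule M W \<longleftrightarrow> module.subspace (scl M) W \<and>
     e_op M ` W \<subseteq> W \<and> f_op M ` W \<subseteq> W \<and> k_op M ` W \<subseteq> W \<and> kinv_op M ` W \<subseteq> W"

definition irreducible_submodule :: "('a::field, 'v::ab_group_add) uq_structure \<Rightarrow> 'v set \<Rightarrow> bool" where
  "irreducible_submodule M W \<longleftrightarrow> submodule M W \<and> W \<noteq> {0} \<and>
     (\<forall>U. submodule M U \<and> U \<subseteq> W \<longrightarrow> U = {0} \<or> U = W)"

text \<open>
  The submodule \<open>W\<close> is a copy of the module of dimension \<open>d + 1\<close>: an isomorphism onto \<open>W\<close> amounts to
  a basis of \<open>W\<close> with the action that defines this module.
\<close>

definition iso_Vd :: "'a::field \<Rightarrow> ('a, 'v::ab_group_add) uq_structure \<Rightarrow> nat \<Rightarrow> 'v set \<Rightarrow> bool" where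
  "iso_Vd q M d W \<longleftrightarrow> (\<exists>v :: nat \<Rightarrow> 'v.
     inj_on v {0..d} \<and> \<not> module.dependent (scl M) (v ` {0..d}) \<and>
     module.span (scl M) (v ` {0..d}) = W \<and>
     (\<forall>i\<in>{0..d}. k_op M (v i) = scl M (q powi (int d - 2 * int i)) (v i)) \<and>
     (\<forall>i<d. f_op M (v i) = scl M (qint q (i + 1)) (v (i + 1))) \<and>
     f_op M (v d) = 0 \<and>
     (\<forall>i\<in>{1..d}. e_op M (v i) = scl M (qint q (d - i + 1)) (v (i - 1))) \<and>
     e_op M (v 0) = 0)"

definition direct_sum_decomp :: "nat \<Rightarrow> (nat \<Rightarrow> 'v::ab_group_add set) \<Rightarrow> bool" where
  "direct_sum_decomp n W \<longleftrightarrow>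
     (\<forall>v. \<exists>!w :: nat \<Rightarrow> 'v. (\<forall>i<n. w i \<in> W i) \<and> (\<forall>i\<ge>n. w i = 0) \<and> v = (\<Sum>i<n. w i))"

definition type_1_module :: "'a::field \<Rightarrow> ('a, 'v::ab_group_add) uq_structure \<Rightarrow> bool" where
  "type_1_module q M \<longleftrightarrow> uq_module q M \<and> fin_dim M \<and> (\<exists>v::'v. v \<noteq> 0) \<and>
     (\<exists>n W. direct_sum_decomp n W \<and>
        (\<forall>i<n. irreducible_submodule M (W i) \<and> (\<exists>d. iso_Vd q M d (W i))))"

definition weight_space :: "'a::field \<Rightarrow> ('a, 'v::ab_group_add) uq_structure \<Rightarrow> int \<Rightarrow> 'v set" where
  "weight_space q M \<mu> = {v. k_op M v = scl M (q powi \<mu>) v}"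

text \<open>The linear operator that is \<open>F \<mu>\<close> on each weight space; it is unique because a type 1 module
  is the sum of its weight spaces.\<close>

definition weightwise ::
  "'a::field \<Rightarrow> ('a, 'v::ab_group_add) uq_structure \<Rightarrow> (int \<Rightarrow> 'v \<Rightarrow> 'v) \<Rightarrow> 'v \<Rightarrow> 'v" where
  "weightwise q M F = (THE S. Vector_Spaces.linear (scl M) (scl M) S \<and>
     (\<forall>\<mu>. \<forall>v\<in>weight_space q M \<mu>. S v = F \<mu> v))"

text \<open>Sums over all of \<open>\<nat>\<close> (here, or over triples) are sums of the nonzero terms
  (\<^const>\<open>Sum_any\<close>); there are only finitely many of these on a finite-dimensional module.\<close>

definition lusztig_T :: "'a::field \<Rightarrow> ('a, 'v::ab_group_add) uq_structure \<Rightarrow> 'v \<Rightarrow> 'v" where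
  "lusztig_T q M = weightwise q M (\<lambda>\<mu> v. Sum_any (\<lambda>(a::nat, b::nat, c::nat).
     if int b - int a - int c = \<mu> then
       scl M ((-1) ^ b * q powi (int b - int a * int c) / (qfact q a * qfact q b * qfact q c))
         ((e_op M ^^ a) ((f_op M ^^ b) ((e_op M ^^ c) v)))
     else 0))"

definition lusztig_T_check :: "'a::field \<Rightarrow> ('a, 'v::ab_group_add) uq_structure \<Rightarrow> 'v \<Rightarrow> 'v" where
  "lusztig_T_check q M = weightwise q M (\<lambda>\<mu> v. Sum_any (\<lambda>(a::nat, b::nat, c::nat).
     if int a - int b + int c = \<mu> then
       scl M ((-1) ^ b * q powi (int b - int a * int c) / (qfact q a * qfact q b * qfact q c))
         ((f_op M ^^ a) ((e_op M ^^ b) ((f_op M ^^ c) v)))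
     else 0))"

text \<open>The parameter \<open>s\<close> is the chosen square root of \<open>q\<close>.\<close>

definition Upsilon :: "'a::field \<Rightarrow> 'a \<Rightarrow> ('a, 'v::ab_group_add) uq_structure \<Rightarrow> 'v \<Rightarrow> 'v" where
  "Upsilon q s M = weightwise q M (\<lambda>\<mu> v. scl M (s powi (- (\<mu> ^ 2))) v)"

record 'v equitable_structure =
  x_op :: "'v \<Rightarrow> 'v"
  y_op :: "'v \<Rightarrow> 'v"
  yinv_op :: "'v \<Rightarrow> 'v"
  z_op :: "'v \<Rightarrow> 'v"

definition k_pow :: "('a, 'v) uq_structure \<Rightarrow> int \<Rightarrow> 'v \<Rightarrow> 'v" where
  "k_pow M m = (if m \<ge> 0 then k_op M ^^ nat m else kinv_op M ^^ nat (- m))"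

text \<open>The equitable generators act on a module through their images in the Chevalley presentation.\<close>

definition primary ::
  "'a::field \<Rightarrow> 'a \<Rightarrow> int \<Rightarrow> ('a, 'v::ab_group_add) uq_structure \<Rightarrow> 'v equitable_structure" where
  "primary q \<theta> t M = \<lparr>
     x_op = (\<lambda>v. kinv_op M v
               - scl M (q powi (1 + t) * (q - inverse q) * inverse \<theta>) (k_pow M (- 1 - t) (e_op M v))),
     y_op = k_op M,
     yinv_op = kinv_op M,
     z_op = (\<lambda>v. kinv_op M v
               + scl M (q powi (- t) * (q - inverse q) * \<theta>) (f_op M (k_pow M t v))) \<rparr>"

definition secondary ::
  "'a::field \<Rightarrow> 'a \<Rightarrow> int \<Rightarrow> ('a, 'v::ab_group_add) uq_structure \<Rightarrow> 'v equitable_structure" where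
  "secondary q \<theta> t M = \<lparr>
     x_op = (\<lambda>v. k_op M v
               - scl M (q powi (1 + t) * (q - inverse q) * inverse \<theta>) (k_pow M (1 + t) (f_op M v))),
     y_op = kinv_op M,
     yinv_op = k_op M,
     z_op = (\<lambda>v. k_op M v
               + scl M (q powi (- t) * (q - inverse q) * \<theta>) (e_op M (k_pow M (- t) v))) \<rparr>"

definition n_x ::
  "'a::field \<Rightarrow> ('a, 'v::ab_group_add) uq_structure \<Rightarrow> 'v equitable_structure \<Rightarrow> 'v \<Rightarrow> 'v" where
  "n_x q M N v = scl M (q / (q - inverse q)) (v - y_op N (z_op N v))"

definition n_z ::
  "'a::field \<Rightarrow> ('a, 'v::ab_group_add) uq_structure \<Rightarrow> 'v equitable_structure \<Rightarrow> 'v \<Rightarrow> 'v" where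
  "n_z q M N v = scl M (q / (q - inverse q)) (v - x_op N (y_op N v))"

definition exp_q :: "'a::field \<Rightarrow> ('a, 'v::ab_group_add) uq_structure \<Rightarrow> ('v \<Rightarrow> 'v) \<Rightarrow> 'v \<Rightarrow> 'v" where
  "exp_q q M \<phi> v = Sum_any (\<lambda>i::nat. scl M (q ^ (i choose 2) / qfact q i) ((\<phi> ^^ i) v))"

definition sqrt_q :: "'a::field \<Rightarrow> 'a \<Rightarrow> 'a" where
  "sqrt_q q \<theta> = (if \<theta> ^ 2 = q then - \<theta> else inverse \<theta>)"

definition R_op ::
  "'a::field \<Rightarrow> 'a \<Rightarrow> ('a, 'v::ab_group_add) uq_structure \<Rightarrow> 'v equitable_structure \<Rightarrow> 'v \<Rightarrow> 'v" where
  "R_op q s M N = exp_q q M (n_x q M N) \<circ> Upsilon q s M \<circ> exp_q q M (n_z q M N)"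

text \<open>\<open>inv S\<close> is meaningful only for a bijection \<open>S\<close>, so invertibility is part of the claim
  that the inverse of \<open>S\<close> is \<open>S'\<close>.\<close>

definition inverse_is :: "('v \<Rightarrow> 'v) \<Rightarrow> ('v \<Rightarrow> 'v) \<Rightarrow> bool" where
  "inverse_is S S' \<longleftrightarrow> bij S \<and> inv S = S'"

end

theory Submission
  imports Defs
begin

text \<open>
  A module of type 1 is spanned by weight strings, the standard bases \<open>v\<^sub>0, \<dots>, v\<^sub>d\<close> of the copies
  of \<open>V\<^sub>d\<close> inside it, and two linear operators that agree on all weight strings are equal. So each
  claim reduces to the scalars by which the operators act on a string. Both sides reverse a string:
  with \<open>s = q\<^sup>1\<^sup>/\<^sup>2\<close>, and \<open>u\<close> defined by \<open>\<theta>\<^sup>-\<^sup>1 = - u / s\<close>,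

    \<open>T v\<^sub>i = (-1)^(d - i) q^((d - i)(i + 1)) v\<^bsub>d - i\<^esub>\<close>,

    \<open>T\<^sup>\<or> v\<^sub>i = (-1)^i q^(i (d - i + 1)) v\<^bsub>d - i\<^esub>\<close>,

    \<open>exp\<^sub>q(n\<^sub>z) R v\<^sub>i = (-1)^i u^(2 i - d) q^(- i (d - i + 1)) v\<^bsub>d - i\<^esub>\<close>.

  The choice of \<open>s\<close> makes \<open>u = 1\<close> when \<open>\<theta>\<^sup>2 = q\<close> and \<open>u = - q\<close> when \<open>\<theta>\<^sup>2 = q\<^sup>-\<^sup>1\<close>. For \<open>u = 1\<close> the last
  operator is inverse to the first one, and for \<open>u = - q\<close> to the second one.

  These scalars come from sums over paths \<open>i \<rightarrow> j \<rightarrow> k \<rightarrow> m\<close> of indices: \<open>T\<close> is a sum of products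
  \<open>e\<^sup>a f\<^sup>b e\<^sup>c\<close>, and on a string \<open>n\<^sub>z\<close> and \<open>n\<^sub>x\<close> are \<open>e\<close> and \<open>f\<close> up to rescaling the basis
  (\<open>n_z_ladder\<close>, \<open>n_x_ladder\<close>), so that \<open>exp\<^sub>q(n\<^sub>z) R\<close> has the same shape. Every path contributes a
  product of three \<open>q\<close>-binomial coefficients, and the sum over \<open>j\<close> always is the one evaluated in
  \<open>q_Vandermonde\<close>, for the parameter \<open>q\<close> or \<open>q\<^sup>-\<^sup>1\<close>. For \<open>T\<close> the restriction on the weight forces
  \<open>m = d - i\<close>, and then a single \<open>k\<close> survives (\<open>Lusztig_coefficient\<close>). For \<open>exp\<^sub>q(n\<^sub>z) R\<close> the sum over
  \<open>k\<close> is a second instance of the same identity, and it vanishes unless \<open>m = d - i\<close>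
  (\<open>equitable_coefficient\<close>).

  Two cancellations make this work. The factor \<open>s^(- (d - 2 j)\<^sup>2)\<close> from \<open>\<Upsilon>\<close> removes the terms that are
  quadratic in \<open>j\<close> from the exponents in the three exponentials. The integer \<open>t\<close> only contributes
  \<open>q^(t (m (d - m) - i (d - i)))\<close>, which is \<open>1\<close> for \<open>m = d - i\<close>.

  This covers the primary identification. The Chevalley involution, which exchanges \<open>e\<close> with \<open>f\<close> and
  \<open>k\<close> with \<open>k\<^sup>-\<^sup>1\<close>, reverses the strings, exchanges \<open>T\<close> with \<open>T\<^sup>\<or>\<close> and the primary with the secondary
  identification, and fixes \<open>\<Upsilon>\<close>; it yields the other two claims, as well as the formula for \<open>T\<^sup>\<or>\<close>.
\<close>

section \<open>Identities for q-binomial coefficients\<close>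

text \<open>The symmetric version, which is invariant under \<open>q \<mapsto> q\<^sup>-\<^sup>1\<close>. It vanishes for \<open>k > n\<close>, so sums over
  paths of indices can run over full ranges.\<close>

definition qbinom :: "'a::field \<Rightarrow> nat \<Rightarrow> nat \<Rightarrow> 'a" where
  "qbinom q n k = (if k \<le> n then qfact q n / (qfact q k * qfact q (n - k)) else 0)"

lemma qfact_0 [simp]: "qfact q 0 = 1"
  by (simp add: qfact_def)

lemma qfact_Suc: "qfact q (Suc n) = qfact q n * qint q (Suc n)"
  by (simp add: qfact_def)

lemma qbinom_eq_0 [simp]: "n < k \<Longrightarrow> qbinom q n k = 0"
  by (simp add: qbinom_def)

lemma qint_inverse [simp]: "qint (inverse q) n = qint q n"
proof -
  have "inverse q powi int n - inverse q powi - int n = - (q powi int n - q powi - int n)"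
    by (simp add: power_int_minus power_inverse)
  moreover have "inverse q - inverse (inverse q) = - (q - inverse q)" by simp
  ultimately show ?thesis unfolding qint_def by (simp only: minus_divide_divide)
qed

lemma qfact_inverse [simp]: "qfact (inverse q) n = qfact q n"
  by (simp add: qfact_def)

lemma qbinom_inverse [simp]: "qbinom (inverse q) n k = qbinom q n k"
  by (simp add: qbinom_def)

locale generic_parameter =
  fixes q :: "'a::field"
  assumes q_nonzero [simp]: "q \<noteq> 0" and q_generic: "not_root_of_unity q"
begin

lemma powi_eq_1_iff: "q powi n = 1 \<longleftrightarrow> n = 0"
proof
  assume h: "q powi n = 1"
  show "n = 0"
  proof (rule ccontr)
    assume n: "n \<noteq> 0"
    have "q ^ nat \<bar>n\<bar> = 1"
      using h by (cases "n \<ge> 0") (auto simp: power_int_def power_inverse)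
    moreover have "nat \<bar>n\<bar> > 0" using n by simp
    ultimately show False using q_generic by (auto simp: not_root_of_unity_def)
  qed
qed simp

lemma powi_inject: "q powi m = q powi n \<longleftrightarrow> m = n"
  using powi_eq_1_iff[of "m - n"] by (simp add: power_int_diff)

lemma denominator_nonzero [simp]: "q - inverse q \<noteq> 0"
  using powi_inject[of 1 "-1"] by (simp add: power_int_minus)

lemma qint_nonzero [simp]: "n > 0 \<Longrightarrow> qint q n \<noteq> 0"
  using powi_inject[of "int n" "- int n"] denominator_nonzero by (simp add: qint_def)

lemma qfact_nonzero [simp]: "qfact q n \<noteq> 0"
  by (auto simp: qfact_def)

lemma qbinom_0_right [simp]: "qbinom q n 0 = 1"
  by (simp add: qbinom_def)

lemma qbinom_self [simp]: "qbinom q n n = 1"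
  by (simp add: qbinom_def)

lemma qint_split:
  assumes "k \<le> n"
  shows "qint q (Suc n) = q powi (int k + 1) * qint q (n - k) + q powi (int k - int n) * qint q (Suc k)"
proof -
  have "q powi (int k + 1) * (q powi int (n - k) - q powi - int (n - k))
      + q powi (int k - int n) * (q powi int (Suc k) - q powi - int (Suc k))
      = q powi int (Suc n) - q powi - int (Suc n)"
    using assms by (simp add: right_diff_distrib of_nat_diff add.commute flip: power_int_add)
  then show ?thesis
    unfolding qint_def by (simp add: add_divide_distrib[symmetric] del: of_nat_Suc)
qed

lemma qbinom_Pascal:
  "qbinom q (Suc n) (Suc k)
     = q powi (int k + 1) * qbinom q n (Suc k) + q powi (int k - int n) * qbinom q n k"
proof -
  consider "k < n" | "k = n" | "n < k" by linarith
  then show ?thesis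
  proof cases
    case 1
    define m where "m = n - Suc k"
    have n: "n = Suc (k + m)" using 1 by (simp add: m_def)
    have "qint q (Suc n) = q powi (int k + 1) * qint q (Suc m) + q powi (int k - int n) * qint q (Suc k)"
      using qint_split[of k n] 1 by (simp add: n)
    moreover have "Suc n - Suc k = Suc m" "n - k = Suc m" "n - Suc k = m" "Suc k \<le> n" "k \<le> n"
      by (auto simp: n)
    moreover have "qint q (Suc k) \<noteq> 0" "qint q (Suc m) \<noteq> 0" by simp_all
    ultimately show ?thesis
      by (simp add: qbinom_def qfact_Suc[of q n] qfact_Suc[of q k] qfact_Suc[of q m] del: of_nat_Suc)
         (simp add: field_simps)
  qed auto
qed

end

lemma generic_inverse: "generic_parameter q \<Longrightarrow> generic_parameter (inverse q)"
  by (auto simp: generic_parameter_def not_root_of_unity_def power_inverse)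

context generic_parameter
begin

text \<open>The mirror image of the previous rule under \<open>q \<mapsto> q\<^sup>-\<^sup>1\<close>.\<close>

lemma qbinom_Pascal':
  "qbinom q (Suc n) (Suc k)
     = q powi (- int k - 1) * qbinom q n (Suc k) + q powi (int n - int k) * qbinom q n k"
  using generic_parameter.qbinom_Pascal[OF generic_inverse[OF generic_parameter_axioms], of n k]
  by (simp add: power_int_inverse flip: power_int_minus)

text \<open>Both sides satisfy a three-term recursion in \<open>k\<close>: on the left, \<open>qbinom_Pascal\<close> splits the factor
  \<open>qbinom q (Suc k) j\<close>, which gives \<open>F (k + 1) M = F k M - q^(N - 2 k) F k (M - 1)\<close>; on the right this
  is \<open>qbinom_Pascal'\<close>.\<close>

lemma q_Vandermonde:
  assumes "k \<le> N + M"
  shows "(\<Sum>j\<le>k. (-1) ^ j * q powi (int j * (1 + int N - int k)) * qbinom q k j * qbinom q (N + M - j) N)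
     = q powi (- (int k * int M)) * qbinom q (N + M - k) M"
  using assms
proof (induction k arbitrary: M)
  case 0
  have "qbinom q (N + M) N = qbinom q (N + M) M" by (simp add: qbinom_def mult.commute)
  then show ?case by simp
next
  case (Suc k)
  \<comment> \<open>\<open>P\<close> and \<open>R\<close> are the contributions of the two summands of \<open>qbinom_Pascal\<close>; the second one
    lowers \<open>N + M - j\<close> by one when \<open>j\<close> is shifted, hence the passage from \<open>M\<close> to \<open>M - 1\<close>.\<close>
  define F where "F = (\<lambda>k M. \<Sum>j\<le>k. (-1) ^ j * q powi (int j * (1 + int N - int k))
     * qbinom q k j * qbinom q (N + M - j) N)"
  define X where "X = (\<lambda>j. (-1) ^ j * q powi (int j * (int N - int k)) * qbinom q (N + M - j) N)"
  define P where "P = (\<lambda>j. X j * q powi int j * qbinom q k j)"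
  define R where "R = (\<lambda>j. X (Suc j) * q powi (int j - int k) * qbinom q k j)"
  have "F (Suc k) M = (\<Sum>j\<le>Suc k. X j * qbinom q (Suc k) j)"
    unfolding F_def X_def by (intro sum.cong) (auto simp: algebra_simps)
  also have "\<dots> = X 0 + (\<Sum>j\<le>k. X (Suc j) * qbinom q (Suc k) (Suc j))"
    by (subst sum.atMost_Suc_shift) simp
  also have "(\<Sum>j\<le>k. X (Suc j) * qbinom q (Suc k) (Suc j)) = (\<Sum>j\<le>k. P (Suc j)) + (\<Sum>j\<le>k. R j)"
    unfolding qbinom_Pascal P_def R_def
    by (simp add: distrib_left sum.distrib add.commute mult.assoc)
  also have "X 0 = P 0" by (simp add: P_def)
  also have "P 0 + ((\<Sum>j\<le>k. P (Suc j)) + (\<Sum>j\<le>k. R j)) = (\<Sum>j\<le>Suc k. P j) + (\<Sum>j\<le>k. R j)"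
    by (subst sum.atMost_Suc_shift) (simp add: add.assoc)
  also have "(\<Sum>j\<le>Suc k. P j) = F k M"
  proof -
    have "q powi (int j * (1 + int N - int k)) = q powi (int j * (int N - int k)) * q powi int j" for j
      by (subst power_int_add[symmetric]) (auto simp: algebra_simps)
    then show ?thesis unfolding F_def by (simp add: P_def X_def mult_ac)
  qed
  finally have rec: "F (Suc k) M = F k M + (\<Sum>j\<le>k. R j)" .
  show ?case
  proof (cases M)
    case 0
    have "R j = 0" for j
      using Suc.prems 0 by (cases N) (auto simp: R_def X_def)
    then show ?thesis using rec Suc.IH[of 0] Suc.prems 0 by (auto simp: F_def)
  next
    case (Suc M')
    have "R j = - (q powi (int N - 2 * int k)) * ((-1) ^ j * q powi (int j * (1 + int N - int k))
     * qbinom q k j * qbinom q (N + M' - j) N)" for j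
      unfolding R_def X_def Suc by (simp add: algebra_simps flip: power_int_add)
    then have "(\<Sum>j\<le>k. R j) = - (q powi (int N - 2 * int k)) * F k M'"
      unfolding F_def by (simp only: sum_distrib_left)
    moreover have "k \<le> N + M'" using Suc.prems Suc by simp
    moreover have "F k M' = q powi (- (int k * int M')) * qbinom q (N + M' - k) M'"
      unfolding F_def using \<open>k \<le> N + M'\<close> by (rule Suc.IH)
    moreover have "F k M = q powi (- (int k * int M)) * qbinom q (N + M - k) M"
      unfolding F_def using Suc.prems by (intro Suc.IH) simp
    moreover have "qbinom q (N + M - k) M = q powi (- int M' - 1) * qbinom q (N + M' - k) M
        + q powi (int N - int k) * qbinom q (N + M' - k) M'"
    proof -
      have "N + M - k = Suc (N + M' - k)" "int (N + M' - k) - int M' = int N - int k"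
        using \<open>k \<le> N + M'\<close> Suc by auto
      then show ?thesis by (simp only: Suc qbinom_Pascal')
    qed
    moreover have "q powi (- (int k * int M)) * q powi (- int M' - 1) = q powi (- (int (Suc k) * int M))"
      "q powi (- (int k * int M)) * q powi (int N - int k) = q powi (int N - 2 * int k) * q powi (- (int k * int M'))"
      by (simp_all add: Suc powi_inject algebra_simps flip: power_int_add)
    ultimately have "F (Suc k) M = q powi (- (int (Suc k) * int M)) * qbinom q (N + M' - k) M"
      using rec by (simp only: distrib_left mult.assoc[symmetric]) simp
    then show ?thesis by (simp only: F_def Suc) simp
  qed
qed

lemma qbinom_symmetric: "k \<le> n \<Longrightarrow> qbinom q n (n - k) = qbinom q n k"
  by (simp add: qbinom_def mult.commute)

text \<open>For \<open>i \<le> n\<close>, this is \<open>q_Vandermonde\<close> for \<open>q\<^sup>-\<^sup>1\<close>, \<open>N = i\<close>, \<open>M = n - i\<close> and \<open>k = n\<close>, where the right-hand side is \<open>qbinom q 0 M\<close>.\<close>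

lemma qbinom_orthogonality:
  "(\<Sum>l\<le>n. (-1) ^ l * q powi (int l * (int n - 1 - int i)) * qbinom q n l * qbinom q (n - l) i)
     = (if n = i then 1 else 0)"
proof (cases "i \<le> n")
  case True
  have "(\<Sum>l\<le>n. (-1) ^ l * q powi (int l * (int n - 1 - int i)) * qbinom q n l * qbinom q (n - l) i)
    = (\<Sum>l\<le>n. (-1) ^ l * inverse q powi (int l * (1 + int i - int n)) * qbinom q n l
          * qbinom q (i + (n - i) - l) i)"
    using True by (intro sum.cong) (simp_all add: power_int_inverse algebra_simps flip: power_int_minus)
  also have "\<dots> = inverse q powi (- (int n * int (n - i))) * qbinom q (i + (n - i) - n) (n - i)"
    using generic_parameter.q_Vandermonde[OF generic_inverse[OF generic_parameter_axioms], of n i "n - i"] True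
    by simp
  finally show ?thesis using True by auto
qed (auto intro!: sum.neutral)

text \<open>This is the coefficient of \<open>v\<^sub>m\<close> in \<open>T v\<^sub>i\<close>. The path \<open>i \<rightarrow> j \<rightarrow> k \<rightarrow> m\<close> has \<open>c = i - j\<close>, \<open>b = k - j\<close> and
  \<open>a = k - m\<close>, so the restriction \<open>b - a - c = d - 2 i\<close> says \<open>m = d - i\<close>. The sum over \<open>j\<close> then is
  \<open>q_Vandermonde\<close> for \<open>q\<^sup>-\<^sup>1\<close> with value \<open>qbinom q (d - k) i\<close>; together with \<open>qbinom q i (d - k)\<close> it
  leaves only \<open>k = m\<close>.\<close>

lemma Lusztig_coefficient:
  assumes "i \<le> d" "m \<le> d"
  shows "(\<Sum>k\<le>d. \<Sum>j\<le>d.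
      (if int (k - j) - int (k - m) - int (i - j) = int d - 2 * int i
       then (-1) ^ (k - j) * q powi (int (k - j) - int (k - m) * int (i - j)) else 0)
      * qbinom q (d - j) (d - i) * qbinom q k j * qbinom q (d - m) (d - k))
    = (if m = d - i then (-1) ^ (d - i) * q powi (int (d - i) * (int i + 1)) else 0)"
    (is "(\<Sum>k\<le>d. \<Sum>j\<le>d. ?g k j * _ * _ * _) = ?rhs")
proof (cases "m = d - i")
  case False
  have "?g k j * qbinom q (d - j) (d - i) * qbinom q k j * qbinom q (d - m) (d - k) = 0"
    if "k \<le> d" "j \<le> d" for k j
  proof (cases "j \<le> i \<and> j \<le> k \<and> m \<le> k")
    case True
    then show ?thesis using False assms by (simp add: of_nat_diff)
  next
    case F: False
    then show ?thesis using assms that by (auto simp: not_le)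
  qed
  then show ?thesis using False by (simp add: sum.neutral)
next
  case True
  \<comment> \<open>the part of the summand that is independent of \<open>j\<close>\<close>
  define w where "w = (\<lambda>k. (-1) ^ k * q powi (int k - (int k - int m) * int i) * qbinom q i (d - k))"
  have dm: "d - m = i" using True assms by simp
  have "(\<Sum>j\<le>d. ?g k j * qbinom q (d - j) (d - i) * qbinom q k j * qbinom q (d - m) (d - k))
      = (if k = m then (-1) ^ m * q powi (int m * (int i + 1)) else 0)" if k: "k \<le> d" for k
  proof -
    have "(\<Sum>j\<le>d. ?g k j * qbinom q (d - j) (d - i) * qbinom q k j * qbinom q (d - m) (d - k))
      = (\<Sum>j\<le>d. w k * ((-1) ^ j * inverse q powi (int j * (1 + int m - int k))
            * qbinom q k j * qbinom q (m + i - j) m))"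
    proof (intro sum.cong refl)
      fix j assume j: "j \<in> {..d}"
      show "?g k j * qbinom q (d - j) (d - i) * qbinom q k j * qbinom q (d - m) (d - k)
        = w k * ((-1) ^ j * inverse q powi (int j * (1 + int m - int k))
            * qbinom q k j * qbinom q (m + i - j) m)"
      proof (cases "j \<le> i \<and> j \<le> k \<and> m \<le> k")
        case T: True
        have "q powi (int (k - j) - int (k - m) * int (i - j))
            = q powi (int k - (int k - int m) * int i) * inverse q powi (int j * (1 + int m - int k))"
          using T by (simp add: of_nat_diff power_int_inverse powi_inject algebra_simps
               flip: power_int_add power_int_minus)
        moreover have "int (k - j) - int (k - m) - int (i - j) = int d - 2 * int i"
          using T True assms by linarith
        moreover have "(-1 :: 'a) ^ (k - j) = (-1) ^ k * (-1) ^ j"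
          using T by (simp add: power_diff_conv_inverse flip: power_inverse)
        ultimately show ?thesis using True assms by (simp add: w_def dm mult_ac)
      next
        case F: False
        then consider "i < j" | "k < j" | "k < m" by linarith
        then show ?thesis
        proof cases
          case 1
          then have "d - j < d - i" "m + i - j < m" if "m > 0"
            using j assms True that by auto
          with 1 j assms True show ?thesis by (cases "m = 0") auto
        next
          case 3
          then have "i < d - k" using True assms by simp
          then show ?thesis by (simp add: w_def dm)
        qed simp
      qed
    qed
    also have "\<dots> = w k * (\<Sum>j\<le>d. (-1) ^ j * inverse q powi (int j * (1 + int m - int k))
            * qbinom q k j * qbinom q (m + i - j) m)"
      by (simp add: sum_distrib_left)
    also have "(\<Sum>j\<le>d. (-1) ^ j * inverse q powi (int j * (1 + int m - int k))
            * qbinom q k j * qbinom q (m + i - j) m)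
       = (\<Sum>j\<le>k. (-1) ^ j * inverse q powi (int j * (1 + int m - int k))
            * qbinom q k j * qbinom q (m + i - j) m)"
      using k by (intro sum.mono_neutral_right) auto
    also have "\<dots> = inverse q powi (- (int k * int i)) * qbinom q (m + i - k) i"
      using generic_parameter.q_Vandermonde[OF generic_inverse[OF generic_parameter_axioms], of k m i]
        True assms k by simp
    also have "w k * (inverse q powi (- (int k * int i)) * qbinom q (m + i - k) i)
        = (if k = m then (-1) ^ m * q powi (int m * (int i + 1)) else 0)"
    proof (cases "k = m")
      case True
      have "q powi (int m * (int i + 1)) = q powi int m * q powi (int m * int i)"
        by (subst power_int_add[symmetric]) (auto simp: algebra_simps)
      then show ?thesis using dm True
        by (simp add: w_def power_int_inverse flip: power_int_minus)
    next
      case False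
      then have "i < d - k \<or> m + i - k < i" using True assms k by auto
      with False show ?thesis by (auto simp: w_def)
    qed
    finally show ?thesis .
  qed
  then have "(\<Sum>k\<le>d. \<Sum>j\<le>d. ?g k j * qbinom q (d - j) (d - i) * qbinom q k j * qbinom q (d - m) (d - k))
     = (\<Sum>k\<le>d. if k = m then (-1) ^ m * q powi (int m * (int i + 1)) else 0)"
    by (intro sum.cong) auto
  also have "\<dots> = ?rhs" using assms True by (simp add: sum.delta)
  finally show ?thesis .
qed

section \<open>The coefficients of the product of q-exponentials\<close>

text \<open>These are the matrices of \<open>exp\<^sub>q(n\<^sub>z)\<close> (from \<open>v\<^sub>i\<close> to \<open>v\<^sub>j\<close>) and \<open>exp\<^sub>q(n\<^sub>x)\<close> (from \<open>v\<^sub>j\<close> to \<open>v\<^sub>k\<close>) on a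
  string, as \<open>exp_q_n_z_string\<close> and \<open>exp_q_n_x_string\<close> show. The expressions \<open>i (d - i)\<close> arise by
  summing \<open>d - 2 i - 1\<close>, the mean of the weights of \<open>v\<^sub>i\<close> and \<open>v\<^bsub>i + 1\<^esub>\<close>, along the path.\<close>

definition lowering_coeff :: "'a \<Rightarrow> int \<Rightarrow> nat \<Rightarrow> nat \<Rightarrow> nat \<Rightarrow> 'a" where
  "lowering_coeff \<theta> t d i j = q ^ ((i - j) choose 2) * inverse \<theta> ^ (i - j)
     * q powi (t * (int j * (int d - int j) - int i * (int d - int i))) * qbinom q (d - j) (d - i)"

definition raising_coeff :: "'a \<Rightarrow> int \<Rightarrow> nat \<Rightarrow> nat \<Rightarrow> nat \<Rightarrow> 'a" where
  "raising_coeff \<theta> t d j k = q ^ ((k - j) choose 2) * (- \<theta>) ^ (k - j)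
     * q powi ((t + 1) * (int k * (int d - int k) - int j * (int d - int j))) * qbinom q k j"

lemma two_choose_two: "2 * int (n choose 2) = int n * (int n - 1)"
  by (induction n) (simp_all add: numeral_2_eq_2 algebra_simps)

text \<open>All factors of the path \<open>j + c \<rightarrow> j \<rightarrow> j + b = m + a \<rightarrow> m\<close> apart from the \<open>q\<close>-binomials are powers of \<open>-1\<close>,
  \<open>u\<close> and \<open>s\<close>. Only the factor that contains \<open>t\<close> is kept as a power of \<open>q\<close>, because it does not
  take part in the cancellation of the quadratic exponents.\<close>

lemma equitable_term:
  assumes s: "s ^ 2 = q" and \<theta>: "inverse \<theta> = - (u / s)" and u: "u \<noteq> 0"
  shows "lowering_coeff \<theta> t d (j + c) j * s powi (- ((int d - 2 * int j) ^ 2))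
      * raising_coeff \<theta> t d j (j + b) * lowering_coeff \<theta> t d (m + a) m
    = (-1) ^ (a + c) * u powi (int a + int c - int b)
      * s powi (int c ^ 2 - 2 * int c + int a ^ 2 - 2 * int a - (int b + 2 * int j - int d) ^ 2)
      * q powi (t * ((int j * (int d - int j) - (int j + int c) * (int d - int j - int c))
        + (int m * (int d - int m) - (int m + int a) * (int d - int m - int a))
        + ((int j + int b) * (int d - int j - int b) - int j * (int d - int j))))
      * qbinom q (d - j) (d - (j + c)) * qbinom q (j + b) j * qbinom q (d - m) (d - (m + a))"
proof -
  have s0 [simp]: "s \<noteq> 0" using s q_nonzero by (metis power_zero_numeral)
  have \<theta>0: "\<theta> = - (s / u)" using \<theta> u by (metis inverse_divide inverse_inverse_eq inverse_minus_eq)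
  have qs: "q ^ n = s powi (2 * int n)" for n by (simp add: s[symmetric] power_int_mult flip: power_mult)
  have qs': "q powi n = s powi (2 * n)" for n by (simp add: s[symmetric] power_int_mult)
  have choose: "q ^ (n choose 2) = s powi (int n * (int n - 1))" for n
    by (simp only: qs two_choose_two)
  have lower: "inverse \<theta> ^ n = (-1) ^ n * u powi int n * s powi (- int n)" for n
    unfolding \<theta> by (subst power_minus) (simp add: power_divide power_int_minus field_simps)
  have raise: "(- \<theta>) ^ n = u powi (- int n) * s powi int n" for n
    unfolding \<theta>0 using u by (simp add: power_divide power_int_minus field_simps)
  have t_part: "q powi (t * (int j * (int d - int j) - int (j + c) * (int d - int (j + c))))
      * q powi ((t + 1) * (int (j + b) * (int d - int (j + b)) - int j * (int d - int j)))
      * q powi (t * (int m * (int d - int m) - int (m + a) * (int d - int (m + a))))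
    = q powi (t * ((int j * (int d - int j) - (int j + int c) * (int d - int j - int c))
        + (int m * (int d - int m) - (int m + int a) * (int d - int m - int a))
        + ((int j + int b) * (int d - int j - int b) - int j * (int d - int j))))
      * s powi (2 * (int (j + b) * (int d - int (j + b)) - int j * (int d - int j)))"
    unfolding qs'[symmetric]
    by (simp add: powi_inject algebra_simps flip: power_int_add)
  have s_part: "s powi (int c * (int c - 1)) * s powi (- int c) * s powi (- ((int d - 2 * int j) ^ 2))
      * (s powi (int b * (int b - 1)) * s powi int b)
      * s powi (2 * (int (j + b) * (int d - int (j + b)) - int j * (int d - int j)))
      * (s powi (int a * (int a - 1)) * s powi (- int a))
    = s powi (int c ^ 2 - 2 * int c + int a ^ 2 - 2 * int a - (int b + 2 * int j - int d) ^ 2)"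
    unfolding power_int_add[OF disjI1[OF s0], symmetric]
    by (rule arg_cong[of _ _ "\<lambda>n. s powi n"]) (simp add: power2_eq_square algebra_simps)
  have u_part: "u powi int c * u powi (- int b) * u powi int a = u powi (int a + int c - int b)"
    unfolding power_int_add[OF disjI1[OF u], symmetric] by (simp add: algebra_simps)
  show ?thesis
    unfolding u_part[symmetric] s_part[symmetric] lowering_coeff_def raising_coeff_def
      add_diff_cancel_left' choose lower raise
    using t_part by (simp only: power_add mult_ac)
qed

text \<open>This is the coefficient of \<open>v\<^sub>m\<close> in \<open>exp\<^sub>q(n\<^sub>z) R v\<^sub>i\<close>. After the quadratic terms in \<open>j\<close> and \<open>k\<close> have
  cancelled, the summand depends on \<open>j\<close> as in \<open>q_Vandermonde\<close> with \<open>N = d - i\<close> and \<open>M = i\<close>. What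
  remains of the sum over \<open>k\<close> is \<open>qbinom_orthogonality\<close> with \<open>n = d - m\<close>, after the shift
  \<open>k = m + l\<close>.\<close>

lemma equitable_coefficient:
  assumes s: "s ^ 2 = q" and \<theta>: "inverse \<theta> = - (u / s)" and u: "u \<noteq> 0"
    and i: "i \<le> d" and m: "m \<le> d"
  shows "(\<Sum>k\<le>d. \<Sum>j\<le>d. lowering_coeff \<theta> t d i j * s powi (- ((int d - 2 * int j) ^ 2))
      * raising_coeff \<theta> t d j k * lowering_coeff \<theta> t d k m)
    = (if m = d - i then (-1) ^ i * u powi (2 * int i - int d) * q powi (- (int i * (1 + int d - int i)))
       else 0)"
proof -
  have s0 [simp]: "s \<noteq> 0" using s q_nonzero by (metis power_zero_numeral)
  have qs': "q powi n = s powi (2 * n)" for n by (simp add: s[symmetric] power_int_mult)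
  \<comment> \<open>\<open>C\<close> collects the factors that depend on neither \<open>j\<close> nor \<open>k\<close>, and \<open>W\<close> those that do not depend on \<open>j\<close>.\<close>
  define C where "C = (-1) ^ (i + m) * u powi (int i - int m)
     * s powi (int i ^ 2 - 2 * int i + int m ^ 2 + 2 * int m - int d ^ 2)
     * q powi (t * (int m * (int d - int m) - int i * (int d - int i)))"
  define W where "W = (\<lambda>k. C * (-1) ^ k * q powi (int k * (int d - int m - 1)) * qbinom q (d - m) (d - k))"
  have factor: "lowering_coeff \<theta> t d i j * s powi (- ((int d - 2 * int j) ^ 2))
      * raising_coeff \<theta> t d j k * lowering_coeff \<theta> t d k m
    = W k * ((-1) ^ j * q powi (int j * (1 + int (d - i) - int k)) * qbinom q k j
        * qbinom q (d - i + i - j) (d - i))"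
    if k: "k \<le> d" and j: "j \<le> d" for k j
  proof (cases "j \<le> i \<and> j \<le> k \<and> m \<le> k")
    case True
    then obtain c b a where ij: "i = j + c" and kj: "k = j + b" and km: "k = m + a"
      by (metis le_Suc_ex)
    have b: "int b = int m + int a - int j" using kj km by simp
    have di: "int (d - i) = int d - int j - int c" "d - i + i = d" using i ij by auto
    have dc: "int (d - (c + j)) = int d - int j - int c" using di(1) ij by (simp add: add.commute)
    have sgn: "(-1 :: 'a) ^ (a + c) = (-1) ^ (i + m) * (-1) ^ k * (-1) ^ j"
    proof -
      have "i + m + k + j = (a + c) + 2 * (j + m)" using ij km by simp
      then show ?thesis by (metis (no_types) power_add power_even_eq power_one minus_one_mult_self
          mult.right_neutral power_mult power2_minus one_power2)
    qed
    have e1: "q powi (t * ((int j * (int d - int j) - (int j + int c) * (int d - int j - int c))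
        + (int m * (int d - int m) - (int m + int a) * (int d - int m - int a))
        + ((int j + int b) * (int d - int j - int b) - int j * (int d - int j))))
      = q powi (t * (int m * (int d - int m) - int i * (int d - int i)))"
      by (rule arg_cong[of _ _ "\<lambda>n. q powi n"]) (simp add: ij b algebra_simps)
    have e2: "s powi (int c ^ 2 - 2 * int c + int a ^ 2 - 2 * int a - (int b + 2 * int j - int d) ^ 2)
      = s powi (int i ^ 2 - 2 * int i + int m ^ 2 + 2 * int m - int d ^ 2)
        * q powi (int k * (int d - int m - 1)) * q powi (int j * (1 + int (d - i) - int k))"
      unfolding qs' power_int_add[OF disjI1[OF s0], symmetric]
      by (rule arg_cong[of _ _ "\<lambda>n. s powi n"])
         (simp add: dc ij km b power2_eq_square algebra_simps)
    have e3: "u powi (int a + int c - int b) = u powi (int i - int m)"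
      by (rule arg_cong[of _ _ "\<lambda>n. u powi n"]) (simp add: b ij)
    show ?thesis
      using equitable_term[OF s \<theta> u, of t d j c b m a]
      unfolding e1 e2 e3 sgn ij[symmetric] kj[symmetric] km[symmetric] di(2) W_def C_def
      by (simp only: mult_ac)
  next
    case False
    then consider "i < j" | "k < j" | "k < m" by linarith
    then show ?thesis
    proof cases
      case 1
      then show ?thesis using j by (simp add: lowering_coeff_def)
    next
      case 2
      then show ?thesis by (simp add: raising_coeff_def)
    next
      case 3
      then show ?thesis using k m by (simp add: lowering_coeff_def W_def)
    qed
  qed
  have inner: "(\<Sum>j\<le>d. lowering_coeff \<theta> t d i j * s powi (- ((int d - 2 * int j) ^ 2))
      * raising_coeff \<theta> t d j k * lowering_coeff \<theta> t d k m)
    = W k * (q powi (- (int k * int i)) * qbinom q (d - k) i)" if k: "k \<le> d" for k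
  proof -
    have "(\<Sum>j\<le>d. lowering_coeff \<theta> t d i j * s powi (- ((int d - 2 * int j) ^ 2))
      * raising_coeff \<theta> t d j k * lowering_coeff \<theta> t d k m)
      = W k * (\<Sum>j\<le>d. (-1) ^ j * q powi (int j * (1 + int (d - i) - int k)) * qbinom q k j
        * qbinom q (d - i + i - j) (d - i))"
      unfolding sum_distrib_left using k factor by (intro sum.cong) auto
    also have "(\<Sum>j\<le>d. (-1) ^ j * q powi (int j * (1 + int (d - i) - int k)) * qbinom q k j
        * qbinom q (d - i + i - j) (d - i))
      = (\<Sum>j\<le>k. (-1) ^ j * q powi (int j * (1 + int (d - i) - int k)) * qbinom q k j
        * qbinom q (d - i + i - j) (d - i))"
      using k by (intro sum.mono_neutral_right) auto
    also have "\<dots> = q powi (- (int k * int i)) * qbinom q (d - k) i"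
      using q_Vandermonde[of k "d - i" i] k i by simp
    finally show ?thesis .
  qed
  define n where "n = d - m"
  have "(\<Sum>k\<le>d. \<Sum>j\<le>d. lowering_coeff \<theta> t d i j * s powi (- ((int d - 2 * int j) ^ 2))
      * raising_coeff \<theta> t d j k * lowering_coeff \<theta> t d k m)
    = (\<Sum>k\<le>d. W k * (q powi (- (int k * int i)) * qbinom q (d - k) i))"
    by (intro sum.cong) (auto simp: inner)
  also have "\<dots> = (\<Sum>k\<in>{m..d}. W k * (q powi (- (int k * int i)) * qbinom q (d - k) i))"
    using m by (intro sum.mono_neutral_right) (auto simp: W_def)
  also have "\<dots> = (\<Sum>l\<le>n. W (m + l) * (q powi (- (int (m + l) * int i)) * qbinom q (d - (m + l)) i))"
    by (rule sum.reindex_bij_witness[of _ "\<lambda>l. m + l" "\<lambda>k. k - m"]) (use m in \<open>auto simp: n_def\<close>)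
  also have "\<dots> = (\<Sum>l\<le>n. C * (-1) ^ m * q powi (int m * (int n - 1 - int i))
      * ((-1) ^ l * q powi (int l * (int n - 1 - int i)) * qbinom q n l * qbinom q (n - l) i))"
  proof (intro sum.cong refl)
    fix l assume "l \<in> {..n}"
    then have l: "l \<le> n" by simp
    have "q powi (int (m + l) * (int d - int m - 1)) * q powi (- (int (m + l) * int i))
       = q powi (int m * (int n - 1 - int i)) * q powi (int l * (int n - 1 - int i))"
      using m by (simp add: n_def of_nat_diff powi_inject algebra_simps flip: power_int_add)
    moreover have "d - (m + l) = n - l" "d - m = n" by (auto simp: n_def)
    ultimately show "W (m + l) * (q powi (- (int (m + l) * int i)) * qbinom q (d - (m + l)) i)
      = C * (-1) ^ m * q powi (int m * (int n - 1 - int i))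
      * ((-1) ^ l * q powi (int l * (int n - 1 - int i)) * qbinom q n l * qbinom q (n - l) i)"
      unfolding W_def by (simp only: qbinom_symmetric[OF l] power_add mult_ac) 
  qed
  also have "\<dots> = C * (-1) ^ m * q powi (int m * (int n - 1 - int i)) * (if n = i then 1 else 0)"
    by (simp only: sum_distrib_left[symmetric] qbinom_orthogonality)
  also have "\<dots> = (if m = d - i then (-1) ^ i * u powi (2 * int i - int d)
      * q powi (- (int i * (1 + int d - int i))) else 0)"
  proof (cases "m = d - i")
    case True
    then have di: "int d = int i + int m" "n = i" using i by (auto simp: n_def)
    have S: "s powi (int i ^ 2 - 2 * int i + int m ^ 2 + 2 * int m - int d ^ 2)
        * q powi (int m * (int n - 1 - int i)) = q powi (- (int i * (1 + int d - int i)))"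
      unfolding qs' power_int_add[OF disjI1[OF s0], symmetric]
      by (rule arg_cong[of _ _ "\<lambda>n. s powi n"]) (simp add: di power2_eq_square algebra_simps)
    have sgn: "(-1 :: 'a) ^ (i + m) * (-1) ^ m = (-1) ^ i"
      by (simp add: power_add mult.assoc flip: power_mult_distrib)
    have ex: "int i - int m = 2 * int i - int d"
      "t * (int m * (int d - int m) - int i * (int d - int i)) = 0"
      by (simp_all add: di algebra_simps)
    have "C * (-1) ^ m * q powi (int m * (int n - 1 - int i))
      = ((-1) ^ (i + m) * (-1) ^ m) * u powi (2 * int i - int d)
        * (s powi (int i ^ 2 - 2 * int i + int m ^ 2 + 2 * int m - int d ^ 2)
        * q powi (int m * (int n - 1 - int i)))"
      unfolding C_def ex by (simp only: power_int_0_right mult_1_right mult_1_left mult_ac)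
    then show ?thesis
      unfolding S sgn using True di(2) by (simp only: if_True mult_1_right simp_thms)
  next
    case False
    then show ?thesis using i m by (auto simp: n_def)
  qed
  finally show ?thesis .
qed

end

section \<open>Operators given on weight spaces\<close>

locale uq_representation = generic_parameter q
  for q :: "'a::field" +
  fixes M :: "('a, 'v::ab_group_add) uq_structure"
  assumes uq_module: "uq_module q M"
begin

sublocale vector_space "scl M"
  using uq_module by (simp add: uq_module_def)

sublocale endo: vector_space_pair "scl M" "scl M" ..

abbreviation lin :: "('v \<Rightarrow> 'v) \<Rightarrow> bool" where
  "lin \<equiv> Vector_Spaces.linear (scl M) (scl M)"

abbreviation wt :: "int \<Rightarrow> 'v set" where
  "wt \<equiv> weight_space q M"

lemma linear_generators: "lin (e_op M)" "lin (f_op M)" "lin (k_op M)" "lin (kinv_op M)"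
  using uq_module by (auto simp: uq_module_def)

lemma kinv_k [simp]: "kinv_op M (k_op M v) = v" and k_kinv [simp]: "k_op M (kinv_op M v) = v"
  using uq_module by (auto simp: uq_module_def)

lemma lin_comp: "lin f \<Longrightarrow> lin g \<Longrightarrow> lin (\<lambda>v. f (g v))"
  using Vector_Spaces.linear_compose[of "scl M" "scl M" g "scl M" f] by (simp add: comp_def)

lemma lin_funpow: 
  assumes "lin f" shows "lin (f ^^ n)"
proof (induction n)
  case 0
  show ?case using linear_id by (simp only: funpow_0 funpow.simps(1))
next
  case (Suc n)
  then show ?case using assms lin_comp[of f "f ^^ n"] by (simp add: comp_def)
qed

lemma lin_scale: "lin f \<Longrightarrow> lin (\<lambda>v. scl M a (f v))"
  by (rule endo.linear_compose_scale_right)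

lemma lin_sum: "(\<And>i. i \<in> I \<Longrightarrow> lin (f i)) \<Longrightarrow> lin (\<lambda>v. \<Sum>i\<in>I. f i v)"
  by (rule endo.linear_compose_sum) blast

lemma k_pow_linear: "lin (k_pow M m)"
  using lin_funpow linear_generators by (simp add: k_pow_def)

lemma kinv_weight:
  assumes "v \<in> wt \<mu>"
  shows "kinv_op M v = scl M (q powi (- \<mu>)) v"
proof -
  have "scl M (q powi \<mu>) (kinv_op M v) = kinv_op M (k_op M v)"
    using assms by (simp only: weight_space_def mem_Collect_eq endo.linear_scale[OF linear_generators(4)])
  then have "scl M (q powi (- \<mu>)) (scl M (q powi \<mu>) (kinv_op M v)) = scl M (q powi (- \<mu>)) v"
    by simp
  then show ?thesis by (simp add: power_int_minus)
qed

lemma funpow_eigenvector: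
  assumes "lin f" and "f v = scl M a v"
  shows "(f ^^ n) v = scl M (a ^ n) v"
  using assms by (induction n) (simp_all add: endo.linear_scale mult.commute)

lemma k_pow_weight:
  assumes "v \<in> wt \<mu>"
  shows "k_pow M m v = scl M (q powi (m * \<mu>)) v"
proof (cases "m \<ge> 0")
  case True
  have "k_op M v = scl M (q powi \<mu>) v" using assms by (simp add: weight_space_def)
  from funpow_eigenvector[OF linear_generators(3) this, of "nat m"] True
  show ?thesis by (simp add: k_pow_def mult.commute flip: power_int_mult power_int_of_nat)
next
  case False
  from funpow_eigenvector[OF linear_generators(4) kinv_weight[OF assms], of "nat (- m)"] False
  show ?thesis
    by (simp add: k_pow_def mult.commute del: power_int_minus flip: power_int_mult power_int_of_nat)
qed

text \<open>The operator is defined by linear extension from a basis of weight vectors. It is \<open>F \<mu>\<close> on all of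
  \<open>wt \<mu>\<close>, because a vector of weight \<open>\<mu>\<close> only involves basis vectors of weight \<open>\<mu>\<close>: the powers of
  \<open>q\<close> are distinct, so the eigenvalue equation forces all other coefficients to be \<open>0\<close>.\<close>

lemma weightwise_characterization:
  assumes span: "span (\<Union>\<mu>. wt \<mu>) = UNIV" and F: "\<And>\<mu>. lin (F \<mu>)"
  shows "lin (weightwise q M F)" and "v \<in> wt \<mu> \<Longrightarrow> weightwise q M F v = F \<mu> v"
proof -
  obtain B where B: "B \<subseteq> (\<Union>\<mu>. wt \<mu>)" "independent B" "span B = UNIV"
    using maximal_independent_subset[of "\<Union>\<mu>. wt \<mu>"] span span_span by (metis span_mono top.extremum_unique)
  obtain \<omega> where \<omega>: "\<And>b. b \<in> B \<Longrightarrow> b \<in> wt (\<omega> b)" using B(1) by (metis UN_E subsetD)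
  define S where "S = endo.construct B (\<lambda>b. F (\<omega> b) b)"
  have lin_S: "lin S" unfolding S_def by (rule endo.linear_construct[OF B(2)])
  have S_weight: "S v = F \<mu> v" if v: "v \<in> wt \<mu>" for \<mu> v
  proof -
    obtain X r where X: "finite X" "X \<subseteq> B" "v = (\<Sum>b\<in>X. scl M (r b) b)"
    proof -
      have "v \<in> span B" using B(3) by simp
      then show ?thesis unfolding span_explicit using that by blast
    qed
    have "scl M (q powi \<mu>) v = (\<Sum>b\<in>X. scl M (r b * q powi (\<omega> b)) b)"
    proof -
      have "scl M (q powi \<mu>) v = k_op M v" using v by (simp add: weight_space_def)
      also have "\<dots> = (\<Sum>b\<in>X. scl M (r b) (k_op M b))"
        unfolding X(3) by (simp add: endo.linear_sum endo.linear_scale linear_generators)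
      also have "\<dots> = (\<Sum>b\<in>X. scl M (r b * q powi (\<omega> b)) b)"
        using X(2) \<omega> by (intro sum.cong) (auto simp: weight_space_def)
      finally show ?thesis .
    qed
    then have "(\<Sum>b\<in>X. scl M (r b * q powi (\<omega> b) - r b * q powi \<mu>) b) = 0"
      unfolding X(3) by (simp add: scale_sum_right scale_left_diff_distrib sum_subtractf mult.commute)
    then have "r b * q powi (\<omega> b) - r b * q powi \<mu> = 0" if "b \<in> X" for b
      using independentD[OF B(2) X(1,2), where u = "\<lambda>b. r b * q powi (\<omega> b) - r b * q powi \<mu>"] that by blast
    then have r: "r b = 0 \<or> \<omega> b = \<mu>" if "b \<in> X" for b
      using that by (auto simp: powi_inject)
    have "S v = (\<Sum>b\<in>X. scl M (r b) (F (\<omega> b) b))"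
      using X(2) unfolding X(3) endo.linear_sum[OF lin_S] endo.linear_scale[OF lin_S]
      by (intro sum.cong) (auto simp: S_def endo.construct_basis[OF B(2)])
    also have "\<dots> = (\<Sum>b\<in>X. scl M (r b) (F \<mu> b))"
      using r by (intro sum.cong) auto
    also have "\<dots> = F \<mu> v"
      unfolding X(3) by (simp add: endo.linear_sum[OF F] endo.linear_scale[OF F])
    finally show ?thesis .
  qed
  have "weightwise q M F = S"
    unfolding weightwise_def
  proof (rule the_equality)
    fix S' assume S': "lin S' \<and> (\<forall>\<mu>. \<forall>v\<in>wt \<mu>. S' v = F \<mu> v)"
    show "S' = S"
    proof
      fix v
      show "S' v = S v"
        by (rule endo.linear_eq_on_span[of S' S "\<Union>\<mu>. wt \<mu>"]) (use S' lin_S S_weight span in auto)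
    qed
  qed (use lin_S S_weight in auto)
  then show "lin (weightwise q M F)" "v \<in> wt \<mu> \<Longrightarrow> weightwise q M F v = F \<mu> v"
    using lin_S S_weight by auto
qed

section \<open>q-exponentials on ladders\<close>

text \<open>A ladder records how \<open>e\<close> acts on the standard basis of \<open>V\<^sub>d\<close>. As \<open>f\<close> acts in the same way on the
  reversed basis, each statement about a ladder also serves for \<open>f\<close>.\<close>

definition ladder :: "nat \<Rightarrow> ('v \<Rightarrow> 'v) \<Rightarrow> (nat \<Rightarrow> 'v) \<Rightarrow> bool" where
  "ladder d \<phi> v \<longleftrightarrow> \<phi> (v 0) = 0 \<and> (\<forall>i<d. \<phi> (v (Suc i)) = scl M (qint q (d - i)) (v i))"

lemma ladder_funpow:
  assumes "ladder d \<phi> v" and "lin \<phi>" and "j + c \<le> d"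
  shows "(\<phi> ^^ c) (v (j + c)) = scl M (qfact q (d - j) / qfact q (d - j - c)) (v j)"
  using assms(3)
proof (induction c)
  case (Suc c)
  have "(\<phi> ^^ Suc c) (v (j + Suc c)) = (\<phi> ^^ c) (\<phi> (v (Suc (j + c))))"
    by (simp add: funpow_swap1)
  also have "\<phi> (v (Suc (j + c))) = scl M (qint q (d - (j + c))) (v (j + c))"
    using assms(1) Suc.prems by (simp add: ladder_def)
  also have "(\<phi> ^^ c) \<dots> = scl M (qint q (d - (j + c)) * (qfact q (d - j) / qfact q (d - j - c))) (v j)"
    using Suc by (simp add: endo.linear_scale[OF lin_funpow[OF assms(2)]])
  also have "qint q (d - (j + c)) * (qfact q (d - j) / qfact q (d - j - c))
      = qfact q (d - j) / qfact q (d - j - Suc c)"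
  proof -
    obtain r where r: "d - j - Suc c = r" "d - j - c = Suc r" "d - (j + c) = Suc r"
      using Suc.prems by (metis Suc_diff_Suc Suc_le_lessD add_Suc_right diff_diff_left)
    show ?thesis unfolding r by (simp add: qfact_Suc)
  qed
  finally show ?case .
qed simp

lemma ladder_funpow_eq_0:
  assumes "ladder d \<phi> v" and "lin \<phi>" and "i \<le> d" and "i < c"
  shows "(\<phi> ^^ c) (v i) = 0"
  using assms(3,4)
proof (induction i arbitrary: c)
  case 0
  then obtain c' where "c = Suc c'" by (cases c) auto
  then show ?case using assms(1)
    by (simp add: funpow_swap1 ladder_def endo.linear_0[OF lin_funpow[OF assms(2)]])
next
  case (Suc i)
  then obtain c' where c: "c = Suc c'" "i < c'" by (cases c) auto
  have "\<phi> (v (Suc i)) = scl M (qint q (d - i)) (v i)"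
    using assms(1) Suc.prems by (simp add: ladder_def)
  then show ?case using Suc.IH[of c'] Suc.prems c
    by (simp add: funpow_swap1 endo.linear_scale[OF lin_funpow[OF assms(2)]])
qed

text \<open>Divided powers act on a ladder by \<open>q\<close>-binomial coefficients. The operators \<open>L c\<close>, applied after the
  \<open>c\<close>-th divided power, allow the lemma to be used for \<open>q\<close>-exponentials, and repeatedly for the
  products of three divided powers in Lusztig's operators.\<close>

lemma ladder_sum:
  assumes "ladder d \<phi> v" and "lin \<phi>" and "i \<le> d" and "i < n" and L: "\<And>c. lin (L c)"
  shows "(\<Sum>c<n. L c (scl M (inverse (qfact q c)) ((\<phi> ^^ c) (v i))))
     = (\<Sum>j\<le>d. scl M (qbinom q (d - j) (d - i)) (L (i - j) (v j)))"
proof -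
  have "(\<Sum>c<n. L c (scl M (inverse (qfact q c)) ((\<phi> ^^ c) (v i))))
      = (\<Sum>c\<le>i. L c (scl M (inverse (qfact q c)) ((\<phi> ^^ c) (v i))))"
    using assms(4) ladder_funpow_eq_0[OF assms(1-3)]
    by (intro sum.mono_neutral_right) (auto simp: endo.linear_0[OF L])
  also have "\<dots> = (\<Sum>j\<le>i. L (i - j) (scl M (inverse (qfact q (i - j))) ((\<phi> ^^ (i - j)) (v i))))"
    by (rule sum.reindex_bij_witness[of _ "\<lambda>j. i - j" "\<lambda>c. i - c"]) auto
  also have "\<dots> = (\<Sum>j\<le>i. scl M (qbinom q (d - j) (d - i)) (L (i - j) (v j)))"
  proof (intro sum.cong refl)
    fix j assume "j \<in> {..i}"
    then have j: "j \<le> i" by simp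
    have "(\<phi> ^^ (i - j)) (v i) = scl M (qfact q (d - j) / qfact q (d - i)) (v j)"
      using ladder_funpow[OF assms(1,2), of j "i - j"] j assms(3) by simp
    moreover have "inverse (qfact q (i - j)) * (qfact q (d - j) / qfact q (d - i))
        = qbinom q (d - j) (d - i)"
      using j assms(3) by (simp add: qbinom_def divide_simps)
    ultimately show "L (i - j) (scl M (inverse (qfact q (i - j))) ((\<phi> ^^ (i - j)) (v i)))
        = scl M (qbinom q (d - j) (d - i)) (L (i - j) (v j))"
      by (simp add: endo.linear_scale[OF L])
  qed
  also have "\<dots> = (\<Sum>j\<le>d. scl M (qbinom q (d - j) (d - i)) (L (i - j) (v j)))"
    using assms(3) by (intro sum.mono_neutral_left) auto
  finally show ?thesis .
qed

lemma reverse_ladder_sum: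
  assumes "ladder d \<phi> (\<lambda>i. v (d - i))" and "lin \<phi>" and "j \<le> d" and "d < n" and L: "\<And>c. lin (L c)"
  shows "(\<Sum>b<n. L b (scl M (inverse (qfact q b)) ((\<phi> ^^ b) (v j))))
     = (\<Sum>k\<le>d. scl M (qbinom q k j) (L (k - j) (v k)))"
proof -
  have "(\<Sum>b<n. L b (scl M (inverse (qfact q b)) ((\<phi> ^^ b) (v j))))
     = (\<Sum>l\<le>d. scl M (qbinom q (d - l) j) (L (d - j - l) (v (d - l))))"
    using ladder_sum[OF assms(1,2), of "d - j" n L] L assms(3,4) by simp
  also have "\<dots> = (\<Sum>k\<le>d. scl M (qbinom q k j) (L (k - j) (v k)))"
    by (rule sum.reindex_bij_witness[of _ "\<lambda>k. d - k" "\<lambda>l. d - l"]) (auto simp: diff_commute add.commute)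
  finally show ?thesis .
qed

lemma exp_q_eq_sum:
  assumes "\<And>c. n \<le> c \<Longrightarrow> (\<phi> ^^ c) v = 0"
  shows "exp_q q M \<phi> v = (\<Sum>c<n. scl M (q ^ (c choose 2)) (scl M (inverse (qfact q c)) ((\<phi> ^^ c) v)))"
proof -
  have "{c. scl M (q ^ (c choose 2) / qfact q c) ((\<phi> ^^ c) v) \<noteq> 0} \<subseteq> {..<n}"
    using assms by (auto simp: not_less[symmetric])
  then show ?thesis
    unfolding exp_q_def by (subst Sum_any.expand_superset[of "{..<n}"]) (auto simp: divide_inverse)
qed

lemma exp_q_linear:
  assumes "lin \<phi>" and "\<And>c v. n \<le> c \<Longrightarrow> (\<phi> ^^ c) v = 0"
  shows "lin (exp_q q M \<phi>)"
proof -
  have "exp_q q M \<phi> = (\<lambda>v. \<Sum>c<n. scl M (q ^ (c choose 2)) (scl M (inverse (qfact q c)) ((\<phi> ^^ c) v)))"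
    using exp_q_eq_sum[OF assms(2)] by (intro ext) blast
  then show ?thesis by (simp only:) (intro lin_sum lin_scale lin_funpow assms(1))
qed

lemma exp_q_ladder:
  assumes "ladder d \<phi> v" and "lin \<phi>" and "i \<le> d"
  shows "exp_q q M \<phi> (v i)
     = (\<Sum>j\<le>d. scl M (q ^ ((i - j) choose 2) * qbinom q (d - j) (d - i)) (v j))"
proof -
  have "exp_q q M \<phi> (v i)
      = (\<Sum>c<Suc i. scl M (q ^ (c choose 2)) (scl M (inverse (qfact q c)) ((\<phi> ^^ c) (v i))))"
    using ladder_funpow_eq_0[OF assms] by (intro exp_q_eq_sum) auto
  also have "\<dots> = (\<Sum>j\<le>d. scl M (qbinom q (d - j) (d - i)) (scl M (q ^ ((i - j) choose 2)) (v j)))"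
    by (rule ladder_sum[OF assms, where L = "\<lambda>c. scl M (q ^ (c choose 2))"]) (simp_all add: linear_scale_self)
  finally show ?thesis by (simp only: scale_scale mult.commute)
qed

lemma exp_q_reverse_ladder:
  assumes "ladder d \<phi> (\<lambda>i. v (d - i))" and "lin \<phi>" and "j \<le> d"
  shows "exp_q q M \<phi> (v j) = (\<Sum>k\<le>d. scl M (q ^ ((k - j) choose 2) * qbinom q k j) (v k))"
proof -
  have "exp_q q M \<phi> (v j) = (\<Sum>l\<le>d. scl M (q ^ ((d - j - l) choose 2) * qbinom q (d - l) j) (v (d - l)))"
    using exp_q_ladder[OF assms(1,2), of "d - j"] assms(3) by simp
  also have "\<dots> = (\<Sum>k\<le>d. scl M (q ^ ((k - j) choose 2) * qbinom q k j) (v k))"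
    by (rule sum.reindex_bij_witness[of _ "\<lambda>k. d - k" "\<lambda>l. d - l"]) (auto simp: diff_commute add.commute)
  finally show ?thesis .
qed

lemma collect_coefficients:
  "(\<Sum>j\<in>J. scl M (A j) (\<Sum>k\<in>K. scl M (B j k) (\<Sum>m\<in>N. scl M (C j k m) (v m))))
     = (\<Sum>m\<in>N. scl M (\<Sum>k\<in>K. \<Sum>j\<in>J. A j * B j k * C j k m) (v m))"
proof -
  have "(\<Sum>j\<in>J. scl M (A j) (\<Sum>k\<in>K. scl M (B j k) (\<Sum>m\<in>N. scl M (C j k m) (v m))))
    = (\<Sum>j\<in>J. \<Sum>k\<in>K. \<Sum>m\<in>N. scl M (A j * B j k * C j k m) (v m))"
    by (simp add: scale_sum_right mult.assoc)
  also have "\<dots> = (\<Sum>k\<in>K. \<Sum>j\<in>J. \<Sum>m\<in>N. scl M (A j * B j k * C j k m) (v m))"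
    by (rule sum.swap)
  also have "\<dots> = (\<Sum>k\<in>K. \<Sum>m\<in>N. \<Sum>j\<in>J. scl M (A j * B j k * C j k m) (v m))"
    by (intro sum.cong refl sum.swap)
  also have "\<dots> = (\<Sum>m\<in>N. \<Sum>k\<in>K. \<Sum>j\<in>J. scl M (A j * B j k * C j k m) (v m))"
    by (rule sum.swap)
  finally show ?thesis by (simp add: scale_sum_left)
qed

section \<open>The equitable generators on weight strings\<close>

definition weight_string :: "nat \<Rightarrow> (nat \<Rightarrow> 'v) \<Rightarrow> bool" where
  "weight_string d v \<longleftrightarrow> (\<forall>i\<le>d. v i \<in> wt (int d - 2 * int i))
     \<and> ladder d (e_op M) v \<and> ladder d (f_op M) (\<lambda>i. v (d - i))"

lemma weight_stringD:
  assumes "weight_string d v"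
  shows "i \<le> d \<Longrightarrow> v i \<in> wt (int d - 2 * int i)"
    and "ladder d (e_op M) v" and "ladder d (f_op M) (\<lambda>i. v (d - i))"
  using assms by (auto simp: weight_string_def)

lemma weight_string_f:
  assumes "weight_string d v"
  shows "i < d \<Longrightarrow> f_op M (v i) = scl M (qint q (Suc i)) (v (Suc i))" and "f_op M (v d) = 0"
proof -
  assume i: "i < d"
  have "f_op M (v (d - Suc (d - Suc i))) = scl M (qint q (d - (d - Suc i))) (v (d - (d - Suc i)))"
    using weight_stringD(3)[OF assms] i by (simp only: ladder_def)
  moreover have "d - Suc (d - Suc i) = i" "d - (d - Suc i) = Suc i" using i by auto
  ultimately show "f_op M (v i) = scl M (qint q (Suc i)) (v (Suc i))" by simp
qed (use weight_stringD(3)[OF assms] in \<open>simp add: ladder_def\<close>)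

lemma weight_string_k:
  assumes "weight_string d v" and "i \<le> d"
  shows "k_op M (v i) = scl M (q powi (int d - 2 * int i)) (v i)"
    and "k_pow M m (v i) = scl M (q powi (m * (int d - 2 * int i))) (v i)"
  using weight_stringD(1)[OF assms] k_pow_weight by (auto simp: weight_space_def)

lemma cancel_denominator: "q / (q - inverse q) * (a * ((q - inverse q) * b)) = q * (a * b)"
proof -
  have "q / D * (a * (D * b)) = q * (a * b)" if "D \<noteq> 0" for D using that by simp
  then show ?thesis using denominator_nonzero by blast
qed

lemma n_z_primary_eq:
  "n_z q M (primary q \<theta> t M)
     = (\<lambda>v. scl M (q powi (2 + t) * inverse \<theta>) (k_pow M (- 1 - t) (e_op M (k_op M v))))"
proof
  fix v
  have "q / (q - inverse q) * (q powi (1 + t) * (q - inverse q) * inverse \<theta>) = q powi (2 + t) * inverse \<theta>"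
  proof -
    have "q powi (2 + t) = q * q powi (1 + t)" using power_int_add[of q 1 "1 + t"] by simp
    then show ?thesis by (simp only: mult.assoc cancel_denominator)
  qed
  then show "n_z q M (primary q \<theta> t M) v
     = scl M (q powi (2 + t) * inverse \<theta>) (k_pow M (- 1 - t) (e_op M (k_op M v)))"
    by (simp add: n_z_def primary_def)
qed

lemma n_x_primary_eq:
  "n_x q M (primary q \<theta> t M)
     = (\<lambda>v. scl M (- (q powi (1 - t) * \<theta>)) (k_op M (f_op M (k_pow M t v))))"
proof
  fix v
  have "q / (q - inverse q) * (q powi (- t) * (q - inverse q) * \<theta>) = q powi (1 - t) * \<theta>"
  proof -
    have "q powi (1 - t) = q * q powi (- t)" using power_int_add[of q 1 "- t"] by simp
    then show ?thesis by (simp only: mult.assoc cancel_denominator)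
  qed
  then show "n_x q M (primary q \<theta> t M) v
     = scl M (- (q powi (1 - t) * \<theta>)) (k_op M (f_op M (k_pow M t v)))"
    by (simp add: n_x_def primary_def endo.linear_add[OF linear_generators(3)]
      endo.linear_scale[OF linear_generators(3)])
qed

lemma n_z_primary_linear: "lin (n_z q M (primary q \<theta> t M))"
  unfolding n_z_primary_eq
  by (intro lin_scale lin_comp[OF k_pow_linear] lin_comp[OF linear_generators(1)] linear_generators)

lemma n_x_primary_linear: "lin (n_x q M (primary q \<theta> t M))"
  unfolding n_x_primary_eq
  by (intro lin_scale lin_comp[OF linear_generators(3)] lin_comp[OF linear_generators(2)] k_pow_linear)

text \<open>After rescaling \<open>v\<^sub>i\<close> by \<open>gauge d \<theta> t i\<close>, the operator \<open>n\<^sub>z\<close> acts as \<open>e\<close> does on \<open>v\<^sub>i\<close>; after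
  rescaling by \<open>gauge d (- \<theta>) (t + 1) i\<close>, the operator \<open>n\<^sub>x\<close> acts as \<open>f\<close> does. Indeed
  \<open>n\<^sub>z v\<^bsub>i + 1\<^esub> = \<theta>\<^sup>-\<^sup>1 q^(- t (d - 2 i - 1)) e v\<^bsub>i + 1\<^esub>\<close> and
  \<open>n\<^sub>x v\<^sub>i = - \<theta> q^((t + 1) (d - 2 i - 1)) f v\<^sub>i\<close>.\<close>

definition gauge :: "nat \<Rightarrow> 'a \<Rightarrow> int \<Rightarrow> nat \<Rightarrow> 'a" where
  "gauge d c r i = c ^ i * q powi (r * (int i * (int d - int i)))"

lemma n_z_ladder:
  assumes v: "weight_string d v" and \<theta>: "\<theta> \<noteq> 0"
  shows "ladder d (n_z q M (primary q \<theta> t M)) (\<lambda>i. scl M (gauge d \<theta> t i) (v i))"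
  unfolding ladder_def
proof (intro conjI allI impI)
  let ?n = "n_z q M (primary q \<theta> t M)"
  have "e_op M (v 0) = 0" using weight_stringD(2)[OF v] by (simp add: ladder_def)
  then show "?n (scl M (gauge d \<theta> t 0) (v 0)) = 0"
    using weight_string_k(1)[OF v, of 0]
    by (simp add: n_z_primary_eq endo.linear_scale[OF linear_generators(1)]
      endo.linear_scale[OF linear_generators(3)] endo.linear_0[OF k_pow_linear])
next
  fix i assume i: "i < d"
  let ?n = "n_z q M (primary q \<theta> t M)"
  have "e_op M (v (Suc i)) = scl M (qint q (d - i)) (v i)"
    using weight_stringD(2)[OF v] i by (simp add: ladder_def)
  then have "?n (v (Suc i)) = scl M (q powi (2 + t) * inverse \<theta> * (q powi (int d - 2 * int (Suc i))
      * (qint q (d - i) * q powi ((- 1 - t) * (int d - 2 * int i))))) (v i)"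
    using weight_string_k[OF v] i unfolding n_z_primary_eq
    by (simp add: endo.linear_scale[OF linear_generators(1)] endo.linear_scale[OF k_pow_linear] Suc_leI
      del: of_nat_Suc)
  moreover have "gauge d \<theta> t (Suc i) * (q powi (2 + t) * inverse \<theta> * (q powi (int d - 2 * int (Suc i))
      * (qint q (d - i) * q powi ((- 1 - t) * (int d - 2 * int i))))) = qint q (d - i) * gauge d \<theta> t i"
  proof -
    have e1: "q powi (t * (int (Suc i) * (int d - int (Suc i)))) * q powi (2 + t)
       * q powi (int d - 2 * int (Suc i)) * q powi ((- 1 - t) * (int d - 2 * int i))
       = q powi (t * (int i * (int d - int i)))"
      unfolding power_int_add[OF disjI1[OF q_nonzero], symmetric]
      by (rule arg_cong[of _ _ "\<lambda>n. q powi n"]) (simp add: algebra_simps)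
    have e2: "\<theta> ^ Suc i * inverse \<theta> = \<theta> ^ i" using \<theta> by simp
    show ?thesis
      unfolding gauge_def e1[symmetric] e2[symmetric] by (simp only: mult_ac)
  qed
  ultimately show "?n (scl M (gauge d \<theta> t (Suc i)) (v (Suc i)))
      = scl M (qint q (d - i)) (scl M (gauge d \<theta> t i) (v i))"
    by (simp only: endo.linear_scale[OF n_z_primary_linear] scale_scale)
qed

lemma n_x_ladder:
  assumes v: "weight_string d v"
  shows "ladder d (n_x q M (primary q \<theta> t M))
    (\<lambda>i. scl M (gauge d (- \<theta>) (t + 1) (d - i)) (v (d - i)))"
  unfolding ladder_def
proof (intro conjI allI impI)
  let ?n = "n_x q M (primary q \<theta> t M)"
  show "?n (scl M (gauge d (- \<theta>) (t + 1) (d - 0)) (v (d - 0))) = 0"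
    using weight_string_k(2)[OF v, of d t] weight_string_f(2)[OF v]
    by (simp add: n_x_primary_eq endo.linear_scale[OF linear_generators(2)]
      endo.linear_scale[OF k_pow_linear] endo.linear_0[OF linear_generators(3)])
next
  fix l assume l: "l < d"
  let ?n = "n_x q M (primary q \<theta> t M)"
  obtain i where i: "d - Suc l = i" "d - l = Suc i" "i < d" "Suc i \<le> d"
    using l that[of "d - Suc l"] by simp
  have "?n (v i) = scl M (- (q powi (1 - t) * \<theta>) * (q powi (t * (int d - 2 * int i))
      * (qint q (Suc i) * q powi (int d - 2 * int (Suc i))))) (v (Suc i))"
    using weight_string_k(1)[OF v i(4)] weight_string_k(2)[OF v, of i] weight_string_f(1)[OF v i(3)] i(3)
    unfolding n_x_primary_eq
    by (simp add: endo.linear_scale[OF linear_generators(2)] endo.linear_scale[OF linear_generators(3)]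
      del: of_nat_Suc)
  moreover have "gauge d (- \<theta>) (t + 1) i * (- (q powi (1 - t) * \<theta>) * (q powi (t * (int d - 2 * int i))
      * (qint q (Suc i) * q powi (int d - 2 * int (Suc i))))) = qint q (Suc i) * gauge d (- \<theta>) (t + 1) (Suc i)"
  proof -
    have "q powi ((t + 1) * (int i * (int d - int i))) * q powi (1 - t)
       * q powi (t * (int d - 2 * int i)) * q powi (int d - 2 * int (Suc i))
       = q powi ((t + 1) * (int (Suc i) * (int d - int (Suc i))))"
      unfolding power_int_add[OF disjI1[OF q_nonzero], symmetric]
      by (rule arg_cong[of _ _ "\<lambda>n. q powi n"]) (simp add: algebra_simps)
    then have "(- \<theta>) ^ Suc i * q powi ((t + 1) * (int (Suc i) * (int d - int (Suc i))))
      = (- \<theta>) ^ i * - \<theta> * (q powi ((t + 1) * (int i * (int d - int i))) * q powi (1 - t)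
       * q powi (t * (int d - 2 * int i)) * q powi (int d - 2 * int (Suc i)))"
      by (simp only: power_Suc2)
    then show ?thesis
      unfolding gauge_def by (simp only: mult_ac mult_minus_left mult_minus_right)
  qed
  ultimately show "?n (scl M (gauge d (- \<theta>) (t + 1) (d - Suc l)) (v (d - Suc l)))
      = scl M (qint q (d - l)) (scl M (gauge d (- \<theta>) (t + 1) (d - l)) (v (d - l)))"
    unfolding i by (simp only: endo.linear_scale[OF n_x_primary_linear] scale_scale)
qed

lemma gauge_nonzero: "c \<noteq> 0 \<Longrightarrow> gauge d c r i \<noteq> 0"
  by (simp add: gauge_def)

lemma gauge_ratio:
  assumes "c \<noteq> 0"
  shows "gauge d c r j / gauge d c r i
    = c powi (int j - int i) * q powi (r * (int j * (int d - int j) - int i * (int d - int i)))"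
proof -
  have "q powi (r * (a - b)) = q powi (r * a) / q powi (r * b)" for a b
    by (simp only: right_diff_distrib[of r] power_int_diff[OF disjI1[OF q_nonzero]])
  then show ?thesis
    using assms by (simp only: gauge_def power_int_diff[OF disjI1[OF assms]] power_int_of_nat) simp
qed

lemma n_z_primary_funpow_eq_0:
  assumes v: "weight_string d v" and \<theta>: "\<theta> \<noteq> 0" and "i \<le> d" and "d < c"
  shows "(n_z q M (primary q \<theta> t M) ^^ c) (v i) = 0"
  using ladder_funpow_eq_0[OF n_z_ladder[OF v \<theta>, of t] n_z_primary_linear assms(3), of c] assms
  by (simp add: endo.linear_scale[OF lin_funpow[OF n_z_primary_linear]] gauge_nonzero)

lemma n_x_primary_funpow_eq_0:
  assumes v: "weight_string d v" and \<theta>: "\<theta> \<noteq> 0" and "i \<le> d" and "d < c"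
  shows "(n_x q M (primary q \<theta> t M) ^^ c) (v i) = 0"
  using ladder_funpow_eq_0[OF n_x_ladder[OF v, of \<theta> t] n_x_primary_linear, of "d - i" c] assms
  by (simp add: endo.linear_scale[OF lin_funpow[OF n_x_primary_linear]] gauge_nonzero)

lemma exp_q_n_z_string:
  assumes v: "weight_string d v" and \<theta>: "\<theta> \<noteq> 0" and i: "i \<le> d"
    and lin: "lin (exp_q q M (n_z q M (primary q \<theta> t M)))"
  shows "exp_q q M (n_z q M (primary q \<theta> t M)) (v i) = (\<Sum>j\<le>d. scl M (lowering_coeff \<theta> t d i j) (v j))"
proof -
  let ?E = "exp_q q M (n_z q M (primary q \<theta> t M))" and ?g = "gauge d \<theta> t"
  have g: "?g i \<noteq> 0" using \<theta> by (rule gauge_nonzero)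
  have "?E (v i) = scl M (inverse (?g i)) (?E (scl M (?g i) (v i)))"
    using g by (simp add: endo.linear_scale[OF lin])
  also have "?E (scl M (?g i) (v i))
      = (\<Sum>j\<le>d. scl M (q ^ ((i - j) choose 2) * qbinom q (d - j) (d - i)) (scl M (?g j) (v j)))"
    by (rule exp_q_ladder[OF n_z_ladder[OF v \<theta>] n_z_primary_linear i])
  also have "scl M (inverse (?g i)) \<dots> = (\<Sum>j\<le>d. scl M (lowering_coeff \<theta> t d i j) (v j))"
    unfolding scale_sum_right scale_scale
  proof (intro sum.cong refl arg_cong2[of _ _ _ _ "scl M"])
    fix j assume "j \<in> {..d}"
    show "inverse (?g i) * (q ^ ((i - j) choose 2) * qbinom q (d - j) (d - i) * ?g j) = lowering_coeff \<theta> t d i j"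
    proof (cases "j \<le> i")
      case True
      have "\<theta> powi (int j - int i) = inverse \<theta> ^ (i - j)"
        proof -
        have "int j - int i = - int (i - j)" using True by simp
        then show ?thesis by (simp only: power_int_minus power_int_of_nat power_inverse)
      qed
      then have "inverse (?g i) * ?g j = inverse \<theta> ^ (i - j)
          * q powi (t * (int j * (int d - int j) - int i * (int d - int i)))"
        using gauge_ratio[OF \<theta>, of d t j i] by (simp add: divide_inverse mult.commute)
      moreover have "inverse (?g i) * (q ^ ((i - j) choose 2) * qbinom q (d - j) (d - i) * ?g j)
          = q ^ ((i - j) choose 2) * (inverse (?g i) * ?g j) * qbinom q (d - j) (d - i)"
        by (simp only: mult_ac)
      ultimately show ?thesis by (simp only: lowering_coeff_def mult.assoc)
    next
      case False
      then show ?thesis using i \<open>j \<in> {..d}\<close> by (simp add: lowering_coeff_def)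
    qed
  qed
  finally show ?thesis .
qed

lemma exp_q_n_x_string:
  assumes v: "weight_string d v" and \<theta>: "\<theta> \<noteq> 0" and j: "j \<le> d"
    and lin: "lin (exp_q q M (n_x q M (primary q \<theta> t M)))"
  shows "exp_q q M (n_x q M (primary q \<theta> t M)) (v j) = (\<Sum>k\<le>d. scl M (raising_coeff \<theta> t d j k) (v k))"
proof -
  let ?E = "exp_q q M (n_x q M (primary q \<theta> t M))" and ?g = "gauge d (- \<theta>) (t + 1)"
  have g: "?g j \<noteq> 0" using \<theta> gauge_nonzero by simp
  have "?E (v j) = scl M (inverse (?g j)) (?E (scl M (?g j) (v j)))"
    using g by (simp add: endo.linear_scale[OF lin])
  also have "?E (scl M (?g j) (v j))
      = (\<Sum>k\<le>d. scl M (q ^ ((k - j) choose 2) * qbinom q k j) (scl M (?g k) (v k)))"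
    by (rule exp_q_reverse_ladder[OF n_x_ladder[OF v] n_x_primary_linear j])
  also have "scl M (inverse (?g j)) \<dots> = (\<Sum>k\<le>d. scl M (raising_coeff \<theta> t d j k) (v k))"
    unfolding scale_sum_right scale_scale
  proof (intro sum.cong refl arg_cong2[of _ _ _ _ "scl M"])
    fix k assume "k \<in> {..d}"
    show "inverse (?g j) * (q ^ ((k - j) choose 2) * qbinom q k j * ?g k) = raising_coeff \<theta> t d j k"
    proof (cases "j \<le> k")
      case True
      have "(- \<theta>) powi (int k - int j) = (- \<theta>) ^ (k - j)"
        proof -
        have "int k - int j = int (k - j)" using True by simp
        then show ?thesis by (simp only: power_int_of_nat)
      qed
      then have "inverse (?g j) * ?g k = (- \<theta>) ^ (k - j)
          * q powi ((t + 1) * (int k * (int d - int k) - int j * (int d - int j)))"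
        using gauge_ratio[of "- \<theta>" d "t + 1" k j] \<theta> by (simp add: divide_inverse mult.commute)
      moreover have "inverse (?g j) * (q ^ ((k - j) choose 2) * qbinom q k j * ?g k)
          = q ^ ((k - j) choose 2) * (inverse (?g j) * ?g k) * qbinom q k j"
        by (simp only: mult_ac)
      ultimately show ?thesis by (simp only: raising_coeff_def mult.assoc)
    next
      case False
      then show ?thesis by (simp add: raising_coeff_def)
    qed
  qed
  finally show ?thesis .
qed

end

section \<open>Action on modules spanned by weight strings\<close>

text \<open>A common bound \<open>D\<close> for the lengths of the strings makes \<open>e\<close>, \<open>f\<close>, \<open>n\<^sub>x\<close> and \<open>n\<^sub>z\<close> nilpotent with a
  uniform exponent, so that the sums over all exponents are finite sums over a fixed range and define linear
  operators.\<close>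

locale spanned_by_strings = uq_representation q M
  for q :: "'a::field" and M :: "('a, 'v::ab_group_add) uq_structure" +
  fixes D :: nat
  assumes spanned: "span {v i | d v i. d \<le> D \<and> i \<le> d \<and> weight_string d v} = UNIV"
begin

lemma linear_eqI:
  assumes "lin A" "lin B"
    and "\<And>d v i. weight_string d v \<Longrightarrow> d \<le> D \<Longrightarrow> i \<le> d \<Longrightarrow> A (v i) = B (v i)"
  shows "A = B"
proof
  fix w
  show "A w = B w"
    by (rule endo.linear_eq_on_span[OF assms(1,2), where B = "{v i | d v i. d \<le> D \<and> i \<le> d \<and> weight_string d v}"])
       (use assms(3) spanned in auto)
qed

lemma funpow_eq_0I:
  assumes "lin \<phi>" and "D < c"
    and "\<And>d v i. weight_string d v \<Longrightarrow> i \<le> d \<Longrightarrow> d < c \<Longrightarrow> (\<phi> ^^ c) (v i) = 0"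
  shows "(\<phi> ^^ c) w = 0"
proof -
  have "\<phi> ^^ c = (\<lambda>_. 0)"
    by (rule linear_eqI) (use assms lin_funpow endo.linear_zero in auto)
  then show ?thesis by simp
qed

lemma e_funpow_eq_0: "D < c \<Longrightarrow> (e_op M ^^ c) w = 0"
proof (rule funpow_eq_0I)
  fix d v i assume h: "weight_string d v" "i \<le> d" "d < c"
  then show "(e_op M ^^ c) (v i) = 0"
    using ladder_funpow_eq_0[OF weight_stringD(2)[OF h(1)] linear_generators(1), of i c] by simp
qed (use linear_generators in auto)

lemma f_funpow_eq_0: "D < c \<Longrightarrow> (f_op M ^^ c) w = 0"
proof (rule funpow_eq_0I)
  fix d v i assume h: "weight_string d v" "i \<le> d" "d < c"
  then show "(f_op M ^^ c) (v i) = 0"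
    using ladder_funpow_eq_0[OF weight_stringD(3)[OF h(1)] linear_generators(2), of "d - i" c] by simp
qed (use linear_generators in auto)

lemma weight_spaces_span: "span (\<Union>\<mu>. wt \<mu>) = UNIV"
proof -
  have "{v i | d v i. d \<le> D \<and> i \<le> d \<and> weight_string d v} \<subseteq> (\<Union>\<mu>. wt \<mu>)"
    using weight_stringD(1) by blast
  from span_mono[OF this] show ?thesis unfolding spanned by blast
qed

lemmas weightwise_linear = weightwise_characterization(1)[OF weight_spaces_span]
  and weightwise_eq = weightwise_characterization(2)[OF weight_spaces_span]

lemma Upsilon_linear: "lin (Upsilon q s M)"
  unfolding Upsilon_def by (intro weightwise_linear linear_scale_self)

lemma Upsilon_string:
  assumes "weight_string d v" and "i \<le> d"
  shows "Upsilon q s M (v i) = scl M (s powi (- ((int d - 2 * int i) ^ 2))) (v i)"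
  unfolding Upsilon_def
  by (rule weightwise_eq) (use assms weight_stringD in \<open>auto intro: linear_scale_self\<close>)

definition Lusztig_weight :: "int \<Rightarrow> nat \<Rightarrow> nat \<Rightarrow> nat \<Rightarrow> 'a" where
  "Lusztig_weight \<mu> a b c =
     (if int b - int a - int c = \<mu> then (-1) ^ b * q powi (int b - int a * int c) else 0)"

text \<open>The sum is ordered as the operators are applied, with \<open>c\<close> outermost, and each factor carries its own
  \<open>q\<close>-factorial; this is the form in which \<open>ladder_sum\<close> applies three times.\<close>

lemma Lusztig_sum:
  "Sum_any (\<lambda>(a::nat, b::nat, c::nat).
     if int b - int a - int c = \<mu> then
       scl M ((-1) ^ b * q powi (int b - int a * int c) / (qfact q a * qfact q b * qfact q c))
         ((e_op M ^^ a) ((f_op M ^^ b) ((e_op M ^^ c) v)))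
     else 0)
   = (\<Sum>c<Suc D. \<Sum>b<Suc D. \<Sum>a<Suc D. scl M (Lusztig_weight \<mu> a b c)
       (scl M (inverse (qfact q a)) ((e_op M ^^ a)
         (scl M (inverse (qfact q b)) ((f_op M ^^ b)
           (scl M (inverse (qfact q c)) ((e_op M ^^ c) v)))))))"
  (is "Sum_any ?s = ?rhs")
proof -
  let ?X = "{..<Suc D} \<times> {..<Suc D} \<times> {..<Suc D}"
  define h where "h = (\<lambda>a b c. ?s (a, b, c))"
  have "?s (a, b, c) = 0" if "(a, b, c) \<notin> ?X" for a b c
  proof -
    from that have "D < a \<or> D < b \<or> D < c" by auto
    then have "(e_op M ^^ a) ((f_op M ^^ b) ((e_op M ^^ c) v)) = 0"
      using e_funpow_eq_0 f_funpow_eq_0 endo.linear_0[OF lin_funpow] linear_generators by metis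
    then show ?thesis by simp
  qed
  then have "{p. ?s p \<noteq> 0} \<subseteq> ?X" by (auto simp: split_paired_all)
  then have "Sum_any ?s = sum ?s ?X" by (intro Sum_any.expand_superset) auto
  also have "\<dots> = (\<Sum>a<Suc D. \<Sum>b<Suc D. \<Sum>c<Suc D. h a b c)"
    unfolding h_def by (simp only: sum.cartesian_product) (intro sum.cong refl, auto)
  also have "\<dots> = (\<Sum>b<Suc D. \<Sum>c<Suc D. \<Sum>a<Suc D. h a b c)"
    by (subst sum.swap) (intro sum.cong refl sum.swap)
  also have "\<dots> = (\<Sum>c<Suc D. \<Sum>b<Suc D. \<Sum>a<Suc D. h a b c)"
    by (rule sum.swap)
  also have "\<dots> = ?rhs"
  proof (intro sum.cong refl)
    fix a b c
    show "h a b c = scl M (Lusztig_weight \<mu> a b c)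
       (scl M (inverse (qfact q a)) ((e_op M ^^ a)
         (scl M (inverse (qfact q b)) ((f_op M ^^ b)
           (scl M (inverse (qfact q c)) ((e_op M ^^ c) v))))))"
      by (simp add: h_def Lusztig_weight_def endo.linear_scale[OF lin_funpow] linear_generators
        divide_inverse mult_ac)
  qed
  finally show ?thesis .
qed

lemma Lusztig_term_linear:
  "lin (\<lambda>v. \<Sum>c<n. \<Sum>b<n. \<Sum>a<n. scl M (Lusztig_weight \<mu> a b c)
       (scl M (inverse (qfact q a)) ((e_op M ^^ a)
         (scl M (inverse (qfact q b)) ((f_op M ^^ b)
           (scl M (inverse (qfact q c)) ((e_op M ^^ c) v)))))))"
  by (intro lin_sum lin_scale lin_comp[OF lin_funpow] linear_generators lin_funpow)

lemma lusztig_T_linear: "lin (lusztig_T q M)"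
  unfolding lusztig_T_def Lusztig_sum by (intro weightwise_linear Lusztig_term_linear)

lemma lusztig_T_string:
  assumes v: "weight_string d v" and d: "d \<le> D" and i: "i \<le> d"
  shows "lusztig_T q M (v i) = scl M ((-1) ^ (d - i) * q powi (int (d - i) * (int i + 1))) (v (d - i))"
proof -
  let ?\<mu> = "int d - 2 * int i"
  \<comment> \<open>what remains to be applied after \<open>f\<^sup>b e\<^sup>c\<close> and after \<open>e\<^sup>c\<close>, respectively\<close>
  define L2 where "L2 = (\<lambda>c b w. \<Sum>a<Suc D. scl M (Lusztig_weight ?\<mu> a b c)
       (scl M (inverse (qfact q a)) ((e_op M ^^ a) w)))"
  define L1 where "L1 = (\<lambda>c w. \<Sum>b<Suc D. L2 c b (scl M (inverse (qfact q b)) ((f_op M ^^ b) w)))"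
  have lin2: "lin (L2 c b)" for c b
    unfolding L2_def by (intro lin_sum lin_scale lin_funpow linear_generators)
  have lin1: "lin (L1 c)" for c
    unfolding L1_def by (intro lin_sum lin_comp[OF lin2] lin_scale lin_funpow linear_generators)
  have L2: "L2 c b (v k) = (\<Sum>m\<le>d. scl M (qbinom q (d - m) (d - k) * Lusztig_weight ?\<mu> (k - m) b c) (v m))"
    if "k \<le> d" for b c k
    unfolding L2_def
    using ladder_sum[OF weight_stringD(2)[OF v] linear_generators(1) that, of "Suc D"
        "\<lambda>a. scl M (Lusztig_weight ?\<mu> a b c)"] that d
    by (simp add: linear_scale_self del: sum.lessThan_Suc)
  have L1: "L1 c (v j) = (\<Sum>k\<le>d. scl M (qbinom q k j) (L2 c (k - j) (v k)))" if "j \<le> d" for c j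
    unfolding L1_def
    using d that by (intro reverse_ladder_sum weight_stringD(3)[OF v] linear_generators lin2) auto
  have "lusztig_T q M (v i) = (\<Sum>c<Suc D. L1 c (scl M (inverse (qfact q c)) ((e_op M ^^ c) (v i))))"
    unfolding lusztig_T_def Lusztig_sum L1_def L2_def
    by (rule weightwise_eq[OF Lusztig_term_linear weight_stringD(1)[OF v i]])
  also have "\<dots> = (\<Sum>j\<le>d. scl M (qbinom q (d - j) (d - i)) (L1 (i - j) (v j)))"
    using d i by (intro ladder_sum weight_stringD(2)[OF v] linear_generators lin1) auto
  also have "\<dots> = (\<Sum>j\<le>d. scl M (qbinom q (d - j) (d - i)) (\<Sum>k\<le>d. scl M (qbinom q k j)
      (\<Sum>m\<le>d. scl M (qbinom q (d - m) (d - k) * Lusztig_weight ?\<mu> (k - m) (k - j) (i - j)) (v m))))"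
    by (simp add: L1 L2)
  also have "\<dots> = (\<Sum>m\<le>d. scl M (\<Sum>k\<le>d. \<Sum>j\<le>d. Lusztig_weight ?\<mu> (k - m) (k - j) (i - j)
      * qbinom q (d - j) (d - i) * qbinom q k j * qbinom q (d - m) (d - k)) (v m))"
    unfolding collect_coefficients by (simp only: mult_ac)
  also have "\<dots> = (\<Sum>m\<le>d. scl M (if m = d - i then (-1) ^ (d - i) * q powi (int (d - i) * (int i + 1)) else 0) (v m))"
    unfolding Lusztig_weight_def using i by (intro sum.cong refl) (simp only: Lusztig_coefficient atMost_iff)
  also have "\<dots> = scl M ((-1) ^ (d - i) * q powi (int (d - i) * (int i + 1))) (v (d - i))"
    by (simp add: if_distrib[of "\<lambda>a. scl M a _"] cong: if_cong)
  finally show ?thesis .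
qed

lemma exp_q_n_z_linear:
  assumes "\<theta> \<noteq> 0"
  shows "lin (exp_q q M (n_z q M (primary q \<theta> t M)))"
proof (rule exp_q_linear[OF n_z_primary_linear, where n = "Suc D"])
  fix c w assume "Suc D \<le> c"
  then have "D < c" by simp
  show "(n_z q M (primary q \<theta> t M) ^^ c) w = 0"
    by (rule funpow_eq_0I[OF n_z_primary_linear \<open>D < c\<close>]) (simp_all add: n_z_primary_funpow_eq_0[OF _ assms])
qed

lemma exp_q_n_x_linear:
  assumes "\<theta> \<noteq> 0"
  shows "lin (exp_q q M (n_x q M (primary q \<theta> t M)))"
proof (rule exp_q_linear[OF n_x_primary_linear, where n = "Suc D"])
  fix c w assume "Suc D \<le> c"
  then have "D < c" by simp
  show "(n_x q M (primary q \<theta> t M) ^^ c) w = 0"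
    by (rule funpow_eq_0I[OF n_x_primary_linear \<open>D < c\<close>]) (simp_all add: n_x_primary_funpow_eq_0[OF _ assms])
qed

abbreviation exp_n_z_R :: "'a \<Rightarrow> 'a \<Rightarrow> int \<Rightarrow> 'v \<Rightarrow> 'v" where
  "exp_n_z_R s \<theta> t \<equiv> exp_q q M (n_z q M (primary q \<theta> t M)) \<circ> R_op q s M (primary q \<theta> t M)"

lemma exp_n_z_R_linear: "\<theta> \<noteq> 0 \<Longrightarrow> lin (exp_n_z_R s \<theta> t)"
  unfolding R_op_def comp_def
  by (intro lin_comp[OF exp_q_n_z_linear] lin_comp[OF exp_q_n_x_linear] lin_comp[OF Upsilon_linear] exp_q_n_z_linear)

lemma exp_n_z_R_string:
  assumes v: "weight_string d v" and i: "i \<le> d"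
    and s: "s ^ 2 = q" and \<theta>: "inverse \<theta> = - (u / s)" and u: "u \<noteq> 0"
  shows "exp_n_z_R s \<theta> t (v i) = scl M ((-1) ^ i * u powi (2 * int i - int d)
      * q powi (- (int i * (1 + int d - int i)))) (v (d - i))"
proof -
  have "s \<noteq> 0" using s q_nonzero by (metis power_zero_numeral)
  then have \<theta>0: "\<theta> \<noteq> 0" using \<theta> u by auto
  note linz = exp_q_n_z_linear[OF \<theta>0, of t] and linx = exp_q_n_x_linear[OF \<theta>0, of t]
  have "exp_n_z_R s \<theta> t (v i) = (\<Sum>j\<le>d. scl M (lowering_coeff \<theta> t d i j * s powi (- ((int d - 2 * int j) ^ 2)))
      (\<Sum>k\<le>d. scl M (raising_coeff \<theta> t d j k) (\<Sum>m\<le>d. scl M (lowering_coeff \<theta> t d k m) (v m))))"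
    unfolding R_op_def comp_def exp_q_n_z_string[OF v \<theta>0 i linz]
    by (simp add: endo.linear_sum[OF linz] endo.linear_scale[OF linz] endo.linear_sum[OF linx]
      endo.linear_scale[OF linx] endo.linear_sum[OF Upsilon_linear] endo.linear_scale[OF Upsilon_linear]
      Upsilon_string[OF v] exp_q_n_x_string[OF v \<theta>0 _ linx] exp_q_n_z_string[OF v \<theta>0 _ linz]
      del: power_int_minus)
  also have "\<dots> = (\<Sum>m\<le>d. scl M (if m = d - i then (-1) ^ i * u powi (2 * int i - int d)
      * q powi (- (int i * (1 + int d - int i))) else 0) (v m))"
    unfolding collect_coefficients
    using i by (intro sum.cong refl) (simp only: equitable_coefficient[OF s \<theta> u] atMost_iff)
  also have "\<dots> = scl M ((-1) ^ i * u powi (2 * int i - int d)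
      * q powi (- (int i * (1 + int d - int i)))) (v (d - i))"
    by (simp add: if_distrib[of "\<lambda>a. scl M a _"] del: power_int_minus cong: if_cong)
  finally show ?thesis .
qed

lemma inverse_isI:
  assumes "lin A" "lin B"
    and A: "\<And>d v i. weight_string d v \<Longrightarrow> d \<le> D \<Longrightarrow> i \<le> d \<Longrightarrow> A (v i) = scl M (\<alpha> d i) (v (d - i))"
    and B: "\<And>d v i. weight_string d v \<Longrightarrow> d \<le> D \<Longrightarrow> i \<le> d \<Longrightarrow> B (v i) = scl M (\<beta> d i) (v (d - i))"
    and inv: "\<And>d i. i \<le> d \<Longrightarrow> \<alpha> d i * \<beta> d (d - i) = 1"
  shows "inverse_is A B"
proof -
  have inv': "\<alpha> d (d - i) * \<beta> d i = 1" if "i \<le> d" for d i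
    using inv[of "d - i" d] that by simp
  have "(\<lambda>w. A (B w)) = (\<lambda>w. w)"
  proof (rule linear_eqI[OF lin_comp[OF assms(1,2)] linear_ident])
    fix d v i assume "weight_string d v" "d \<le> D" "i \<le> d"
    then show "A (B (v i)) = v i"
      using inv'[of i d] by (simp add: A B endo.linear_scale[OF assms(1)] mult.commute)
  qed
  moreover have "(\<lambda>w. B (A w)) = (\<lambda>w. w)"
  proof (rule linear_eqI[OF lin_comp[OF assms(2,1)] linear_ident])
    fix d v i assume "weight_string d v" "d \<le> D" "i \<le> d"
    then show "B (A (v i)) = v i"
      using inv[of i d] by (simp add: A B endo.linear_scale[OF assms(2)])
  qed
  ultimately have AB: "A (B w) = w" "B (A w) = w" for w
    by (simp_all add: fun_eq_iff)
  then have "bij A" by (metis bijI')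
  moreover have "inv A = B" using AB by (intro inv_equality) 
  ultimately show ?thesis by (simp add: inverse_is_def)
qed

end

section \<open>The Chevalley involution\<close>

definition Chevalley_flip :: "('a, 'v) uq_structure \<Rightarrow> ('a, 'v) uq_structure" where
  "Chevalley_flip M = \<lparr>scl = scl M, e_op = f_op M, f_op = e_op M, k_op = kinv_op M, kinv_op = k_op M\<rparr>"

lemma flip_simps [simp]:
  "scl (Chevalley_flip M) = scl M" "e_op (Chevalley_flip M) = f_op M" "f_op (Chevalley_flip M) = e_op M"
  "k_op (Chevalley_flip M) = kinv_op M" "kinv_op (Chevalley_flip M) = k_op M"
  by (simp_all add: Chevalley_flip_def)

lemma flip_flip [simp]: "Chevalley_flip (Chevalley_flip M) = M"
  by (simp add: Chevalley_flip_def)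

lemma k_pow_flip: "k_pow (Chevalley_flip M) m = k_pow M (- m)"
  by (auto simp: k_pow_def)

lemma primary_flip: "primary q \<theta> t (Chevalley_flip M) = secondary q \<theta> t M"
  by (simp add: primary_def secondary_def k_pow_flip add.commute)

lemma equitable_operators_flip:
  "n_x q (Chevalley_flip M) = n_x q M" "n_z q (Chevalley_flip M) = n_z q M" "exp_q q (Chevalley_flip M) = exp_q q M"
  by (simp_all add: fun_eq_iff n_x_def n_z_def exp_q_def)

context uq_representation
begin

lemma weight_space_flip: "weight_space q (Chevalley_flip M) \<mu> = wt (- \<mu>)"
proof (intro set_eqI iffI)
  fix v assume v: "v \<in> weight_space q (Chevalley_flip M) \<mu>"
  have "v = k_op M (kinv_op M v)" by simp
  also have "\<dots> = scl M (q powi \<mu>) (k_op M v)"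
    using v by (simp only: weight_space_def flip_simps mem_Collect_eq endo.linear_scale[OF linear_generators(3)])
  finally have "scl M (q powi (- \<mu>)) v = scl M (q powi (- \<mu>)) (scl M (q powi \<mu>) (k_op M v))"
    by (rule arg_cong)
  then show "v \<in> wt (- \<mu>)" by (simp add: weight_space_def power_int_minus)
qed (use kinv_weight in \<open>force simp: weight_space_def\<close>)

lemma weightwise_flip: "weightwise q (Chevalley_flip M) F = weightwise q M (\<lambda>\<mu>. F (- \<mu>))"
proof -
  have "(\<forall>\<mu>. \<forall>v\<in>wt (- \<mu>). S v = F \<mu> v) \<longleftrightarrow> (\<forall>\<mu>. \<forall>v\<in>wt \<mu>. S v = F (- \<mu>) v)" for S
    by (metis minus_minus)
  then show ?thesis unfolding weightwise_def weight_space_flip flip_simps by simp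
qed

lemma lusztig_T_flip: "lusztig_T q (Chevalley_flip M) = lusztig_T_check q M"
proof -
  have "int b - int a - int c = - \<mu> \<longleftrightarrow> int a - int b + int c = \<mu>" for a b c \<mu> by linarith
  then show ?thesis unfolding lusztig_T_def lusztig_T_check_def weightwise_flip flip_simps by simp
qed

lemma Upsilon_flip: "Upsilon q s (Chevalley_flip M) = Upsilon q s M"
  unfolding Upsilon_def weightwise_flip flip_simps by simp

lemma R_op_flip: "R_op q s (Chevalley_flip M) N = R_op q s M N"
  by (simp add: R_op_def equitable_operators_flip Upsilon_flip)

lemma kinv_e: "kinv_op M (e_op M v) = scl M (q powi (- 2)) (e_op M (kinv_op M v))"
proof -
  have "e_op M v = e_op M (k_op M (kinv_op M v))" by simp
  moreover have "k_op M (e_op M (kinv_op M v)) = scl M (q ^ 2) (e_op M (k_op M (kinv_op M v)))"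
    using uq_module by (simp only: uq_module_def)
  ultimately have "kinv_op M (k_op M (e_op M (kinv_op M v))) = scl M (q ^ 2) (kinv_op M (e_op M v))"
    by (simp add: endo.linear_scale[OF linear_generators(4)])
  then show ?thesis by (simp add: power_int_minus)
qed

lemma kinv_f: "kinv_op M (f_op M v) = scl M (q ^ 2) (f_op M (kinv_op M v))"
proof -
  have "k_op M (f_op M (kinv_op M v)) = scl M (q powi (- 2)) (f_op M (k_op M (kinv_op M v)))"
    using uq_module by (simp only: uq_module_def)
  then have "kinv_op M (k_op M (f_op M (kinv_op M v))) = scl M (q powi (- 2)) (kinv_op M (f_op M v))"
    by (simp add: endo.linear_scale[OF linear_generators(4)])
  then show ?thesis by (simp add: power_int_minus)
qed

lemma flip_representation: "uq_representation q (Chevalley_flip M)"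
proof
  have "f_op M (e_op M v) - e_op M (f_op M v) = scl M (inverse (q - inverse q)) (kinv_op M v - k_op M v)" for v
  proof -
    have "e_op M (f_op M v) - f_op M (e_op M v) = scl M (inverse (q - inverse q)) (k_op M v - kinv_op M v)"
      using uq_module by (simp only: uq_module_def)
    then show ?thesis by (metis minus_diff_eq scale_minus_right)
  qed
  then show "uq_module q (Chevalley_flip M)"
    unfolding uq_module_def flip_simps
    using linear_generators kinv_e kinv_f vector_space_axioms by auto
qed

lemma weight_string_flip:
  assumes "weight_string d v"
  shows "uq_representation.weight_string q (Chevalley_flip M) d (\<lambda>i. v (d - i))"
proof -
  interpret F: uq_representation q "Chevalley_flip M" by (rule flip_representation)
  have "v (d - i) \<in> wt (- (int d - 2 * int i))" if "i \<le> d" for i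
    using weight_stringD(1)[OF assms, of "d - i"] that by (simp add: of_nat_diff)
  moreover have "F.ladder d (e_op M) (\<lambda>i. v (d - (d - i)))"
    using weight_stringD(2)[OF assms] by (simp add: ladder_def F.ladder_def)
  moreover have "F.ladder d (f_op M) (\<lambda>i. v (d - i))"
    using weight_stringD(3)[OF assms] by (simp add: ladder_def F.ladder_def)
  ultimately show ?thesis unfolding F.weight_string_def weight_space_flip by simp
qed

end

section \<open>The inverses of Lusztig's operators\<close>

context spanned_by_strings
begin

lemma flip_spanned: "spanned_by_strings q (Chevalley_flip M) D"
proof -
  interpret F: uq_representation q "Chevalley_flip M" by (rule flip_representation)
  have "{v i | d v i. d \<le> D \<and> i \<le> d \<and> weight_string d v}
      \<subseteq> {v i | d v i. d \<le> D \<and> i \<le> d \<and> F.weight_string d v}"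
  proof
    fix w assume "w \<in> {v i | d v i. d \<le> D \<and> i \<le> d \<and> weight_string d v}"
    then obtain d v i where w: "w = v i" "d \<le> D" "i \<le> d" "weight_string d v" by blast
    have "w = (\<lambda>i. v (d - i)) (d - i) \<and> d \<le> D \<and> d - i \<le> d \<and> F.weight_string d (\<lambda>i. v (d - i))"
      using w weight_string_flip[OF w(4)] by simp
    then show "w \<in> {v i | d v i. d \<le> D \<and> i \<le> d \<and> F.weight_string d v}"
      unfolding mem_Collect_eq by (intro exI)
  qed
  from span_mono[OF this] have "F.span {v i | d v i. d \<le> D \<and> i \<le> d \<and> F.weight_string d v} = UNIV"
    unfolding spanned by (simp add: top.extremum_unique)
  then show ?thesis by unfold_locales
qed

lemma lusztig_T_check_linear: "lin (lusztig_T_check q M)"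
proof -
  interpret F: spanned_by_strings q "Chevalley_flip M" D by (rule flip_spanned)
  show ?thesis using F.lusztig_T_linear by (simp add: lusztig_T_flip)
qed

lemma lusztig_T_check_string:
  assumes v: "weight_string d v" and d: "d \<le> D" and i: "i \<le> d"
  shows "lusztig_T_check q M (v i) = scl M ((-1) ^ i * q powi (int i * (int (d - i) + 1))) (v (d - i))"
proof -
  interpret F: spanned_by_strings q "Chevalley_flip M" D by (rule flip_spanned)
  show ?thesis
    using F.lusztig_T_string[OF weight_string_flip[OF v] d, of "d - i"] i by (simp add: lusztig_T_flip)
qed

text \<open>This is \<open>exp_n_z_R_string\<close> with \<open>u = 1\<close>.\<close>

lemma lusztig_T_inverse:
  assumes "\<theta> ^ 2 = q"
  shows "inverse_is (lusztig_T q M) (exp_n_z_R (- \<theta>) \<theta> t)"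
proof (rule inverse_isI[OF lusztig_T_linear exp_n_z_R_linear])
  show \<theta>: "\<theta> \<noteq> 0" using assms q_nonzero by (metis power_zero_numeral)
  show "exp_n_z_R (- \<theta>) \<theta> t (v i) = scl M ((-1) ^ i * q powi (- (int i * (1 + int d - int i)))) (v (d - i))"
    if "weight_string d v" "i \<le> d" for d v i
    using exp_n_z_R_string[OF that, of "- \<theta>" \<theta> 1 t] assms \<theta> by (simp add: inverse_eq_divide)
  show "((-1) ^ (d - i) * q powi (int (d - i) * (int i + 1)))
      * ((-1) ^ (d - i) * q powi (- (int (d - i) * (1 + int d - int (d - i))))) = 1"
    if "i \<le> d" for d i
  proof -
    have "int (d - i) * (1 + int d - int (d - i)) = int (d - i) * (int i + 1)" using that by simp
    moreover have "(-1) ^ n * x * ((-1) ^ n * inverse x) = 1" if "x \<noteq> 0" for n and x :: 'a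
    proof -
      have "(-1) ^ n * x * ((-1) ^ n * inverse x) = ((-1) ^ n * (-1) ^ n) * (x * inverse x)"
        by (simp only: mult_ac)
      with that show ?thesis by simp
    qed
    ultimately show ?thesis by (simp only: power_int_minus power_int_not_zero q_nonzero simp_thms)
  qed
qed (rule lusztig_T_string)

text \<open>Here \<open>exp_n_z_R_string\<close> applies with \<open>u = - q\<close>, since \<open>\<theta>\<^sup>-\<^sup>1 = q \<theta>\<close>. The factor \<open>(- q)^(2 i - d)\<close> is the ratio between the inverses of
  \<open>T\<^sup>\<or>\<close> and \<open>T\<close> on \<open>v\<^sub>i\<close>.\<close>

lemma lusztig_T_check_inverse:
  assumes "\<theta> ^ 2 = inverse q"
  shows "inverse_is (lusztig_T_check q M) (exp_n_z_R (inverse \<theta>) \<theta> t)"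
proof (rule inverse_isI[OF lusztig_T_check_linear exp_n_z_R_linear])
  show \<theta>: "\<theta> \<noteq> 0" using assms q_nonzero by (metis inverse_nonzero_iff_nonzero power_zero_numeral)
  have s: "inverse \<theta> ^ 2 = q" using assms by (simp add: power_inverse)
  have "q * \<theta> = inverse \<theta>" using \<theta> unfolding s[symmetric] by (simp add: power2_eq_square)
  then have "inverse \<theta> = - (- q / inverse \<theta>)" by (simp add: divide_inverse)
  note S = exp_n_z_R_string[OF _ _ s this, of _ _ _ t]
  show "exp_n_z_R (inverse \<theta>) \<theta> t (v i) = scl M ((-1) ^ i * (- q) powi (2 * int i - int d)
      * q powi (- (int i * (1 + int d - int i)))) (v (d - i))"
    if "weight_string d v" "i \<le> d" for d v i
    using S[OF that] by simp
  show "((-1) ^ i * q powi (int i * (int (d - i) + 1)))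
      * ((-1) ^ (d - i) * (- q) powi (2 * int (d - i) - int d)
        * q powi (- (int (d - i) * (1 + int d - int (d - i))))) = 1"
    if "i \<le> d" for d i
  proof -
    have sgn: "(-1 :: 'a) ^ i * (-1) ^ (d - i) * (-1) powi (2 * int (d - i) - int d) = 1"
    proof -
      have "(-1 :: 'a) ^ i * (-1) ^ (d - i) = (-1) powi int d" using that by (simp flip: power_add)
      moreover have "(-1 :: 'a) powi int d * (-1) powi (2 * int (d - i) - int d) = (-1) powi (2 * int (d - i))"
        by (subst power_int_add[symmetric]) simp_all
      moreover have "(-1 :: 'a) powi (2 * int (d - i)) = 1"
        by (subst power_int_mult) simp
      ultimately show ?thesis by (simp only:)
    qed
    have e1: "(- q) powi (2 * int (d - i) - int d)
        = (-1) powi (2 * int (d - i) - int d) * q powi (2 * int (d - i) - int d)"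
      using power_int_mult_distrib[of "-1" q] by simp
    have e2: "q powi (int i * (int (d - i) + 1)) * q powi (2 * int (d - i) - int d)
        * q powi (- (int (d - i) * (1 + int d - int (d - i)))) = q powi 0"
      unfolding power_int_add[OF disjI1[OF q_nonzero], symmetric] of_nat_diff[OF that]
      by (rule arg_cong[of _ _ "\<lambda>n. q powi n"]) (simp add: algebra_simps)
    have "((-1) ^ i * q powi (int i * (int (d - i) + 1)))
      * ((-1) ^ (d - i) * (- q) powi (2 * int (d - i) - int d)
        * q powi (- (int (d - i) * (1 + int d - int (d - i)))))
      = ((-1 :: 'a) ^ i * (-1) ^ (d - i) * (-1) powi (2 * int (d - i) - int d)) * q powi 0"
      unfolding e1 e2[symmetric] by (simp only: mult_ac)
    then show ?thesis unfolding sgn by simp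
  qed
qed (use lusztig_T_check_string in auto)

end

lemma type_1_spanned_by_strings:
  assumes q: "q \<noteq> 0" "not_root_of_unity q" and M: "type_1_module q M"
  obtains D where "spanned_by_strings q M D"
proof -
  interpret uq_representation q M
    by unfold_locales (use q M in \<open>auto simp: type_1_module_def\<close>)
  obtain n W where W: "direct_sum_decomp n W" "\<And>i. i < n \<Longrightarrow> \<exists>d. iso_Vd q M d (W i)"
    using M unfolding type_1_module_def by blast
  then obtain \<delta> where \<delta>: "\<And>i. i < n \<Longrightarrow> iso_Vd q M (\<delta> i) (W i)" by metis
  define D where "D = (\<Sum>i<n. \<delta> i)"
  let ?X = "{v i | d v i. d \<le> D \<and> i \<le> d \<and> weight_string d v}"
  have "W i \<subseteq> span ?X" if i: "i < n" for i
  proof -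
    obtain v where v: "span (v ` {0..\<delta> i}) = W i"
      "\<forall>l\<in>{0..\<delta> i}. k_op M (v l) = scl M (q powi (int (\<delta> i) - 2 * int l)) (v l)"
      "\<forall>l<\<delta> i. f_op M (v l) = scl M (qint q (l + 1)) (v (l + 1))" "f_op M (v (\<delta> i)) = 0"
      "\<forall>l\<in>{1..\<delta> i}. e_op M (v l) = scl M (qint q (\<delta> i - l + 1)) (v (l - 1))" "e_op M (v 0) = 0"
      using \<delta>[OF i] unfolding iso_Vd_def by blast
    have "weight_string (\<delta> i) v"
      unfolding weight_string_def
    proof (intro conjI)
      show "ladder (\<delta> i) (e_op M) v"
        unfolding ladder_def
      proof (intro conjI allI impI)
        fix l assume "l < \<delta> i"
        then have "e_op M (v (Suc l)) = scl M (qint q (\<delta> i - Suc l + 1)) (v (Suc l - 1))"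
          using v(5) by (metis Suc_leI atLeastAtMost_iff le_add1 plus_1_eq_Suc)
        then show "e_op M (v (Suc l)) = scl M (qint q (\<delta> i - l)) (v l)"
          using \<open>l < \<delta> i\<close> by (simp add: Suc_diff_Suc)
      qed (use v(6) in simp)
      show "ladder (\<delta> i) (f_op M) (\<lambda>l. v (\<delta> i - l))"
        unfolding ladder_def
      proof (intro conjI allI impI)
        fix l assume "l < \<delta> i"
        then have "f_op M (v (\<delta> i - Suc l)) = scl M (qint q (\<delta> i - Suc l + 1)) (v (\<delta> i - Suc l + 1))"
          using v(3) by simp
        then show "f_op M (v (\<delta> i - Suc l)) = scl M (qint q (\<delta> i - l)) (v (\<delta> i - l))"
          using \<open>l < \<delta> i\<close> by (simp add: Suc_diff_Suc)
      qed (use v(4) in simp)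
    qed (use v(2) in \<open>simp add: weight_space_def\<close>)
    moreover have "\<delta> i \<le> D" unfolding D_def using i by (intro member_le_sum) auto
    ultimately have "v l = v l \<and> \<delta> i \<le> D \<and> l \<le> \<delta> i \<and> weight_string (\<delta> i) v" if "l \<le> \<delta> i" for l
      using that by simp
    then have "v l \<in> ?X" if "l \<le> \<delta> i" for l
      unfolding mem_Collect_eq using that by (intro exI)
    then have "v ` {0..\<delta> i} \<subseteq> ?X" by (simp add: image_subset_iff)
    then show ?thesis using v(1) span_mono by blast
  qed
  then have "w \<in> span ?X" for w
    using W(1) unfolding direct_sum_decomp_def by (metis (no_types, lifting) lessThan_iff span_sum subsetD)
  then have "spanned_by_strings q M D" by unfold_locales auto
  then show thesis by (rule that)
qed

theorem theorem9p9:
  fixes q \<theta> :: "'a::field" and t :: int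
    and M :: "('a, 'v::ab_group_add) uq_structure"
  assumes "q \<noteq> 0" and "not_root_of_unity q"
    and "\<exists>r::'a. r ^ 2 = q"
    and "\<theta> ^ 2 = q \<or> \<theta> ^ 2 = inverse q"
    and "type_1_module q M"
  shows "(\<theta> ^ 2 = q \<longrightarrow>
           inverse_is (lusztig_T q M)
             (exp_q q M (n_z q M (primary q \<theta> t M))
               \<circ> R_op q (sqrt_q q \<theta>) M (primary q \<theta> t M))) \<and>
         (\<theta> ^ 2 = q \<longrightarrow>
           inverse_is (lusztig_T_check q M)
             (exp_q q M (n_z q M (secondary q \<theta> t M))
               \<circ> R_op q (sqrt_q q \<theta>) M (secondary q \<theta> t M))) \<and>
         (\<theta> ^ 2 = inverse q \<longrightarrow>
           inverse_is (lusztig_T_check q M)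
             (exp_q q M (n_z q M (primary q \<theta> t M))
               \<circ> R_op q (sqrt_q q \<theta>) M (primary q \<theta> t M))) \<and>
         (\<theta> ^ 2 = inverse q \<longrightarrow>
           inverse_is (lusztig_T q M)
             (exp_q q M (n_z q M (secondary q \<theta> t M))
               \<circ> R_op q (sqrt_q q \<theta>) M (secondary q \<theta> t M)))"
proof -
  obtain D where "spanned_by_strings q M D"
    using type_1_spanned_by_strings assms(1,2,5) by blast
  then interpret spanned_by_strings q M D .
  interpret F: spanned_by_strings q "Chevalley_flip M" D by (rule flip_spanned)
  have check: "lusztig_T_check q (Chevalley_flip M) = lusztig_T q M"
    using F.lusztig_T_flip by simp
  have s: "\<theta> ^ 2 = q \<Longrightarrow> sqrt_q q \<theta> = - \<theta>" "\<theta> ^ 2 = inverse q \<Longrightarrow> sqrt_q q \<theta> = inverse \<theta>"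
    using denominator_nonzero by (auto simp: sqrt_q_def)
  show ?thesis
    using lusztig_T_inverse[of \<theta> t] F.lusztig_T_inverse[of \<theta> t]
      lusztig_T_check_inverse[of \<theta> t] F.lusztig_T_check_inverse[of \<theta> t]
    unfolding primary_flip equitable_operators_flip R_op_flip lusztig_T_flip check
    by (simp add: s)
qed

end
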